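(* Let $p>1$, $p'=\frac{p}{p-1}$, and let $v$ be a weight on $(0,\infty)$ belonging to both classes $M_p$ and $m_p$. A measurable function $h:(0,\infty)\to\mathbb{R}$ belongs to $\mathrm{Ces}_p(v)$ if and only if it admits a factorization $h=f\cdot g$ with $f\in L^p(v)$ and $g\in G_{p'}(v^{1-p'})$. Moreover, for every such $h$, $$[v]_{m_p}\,N(h)\le \|h\|_{\mathrm{Ces}_p(v)}\le (p')^{1/p'}p^{1/p}\,[v]_{M_p}\,N(h),$$ where $$N(h)=\inf\{\|f\|_{L^p(v)}\|g\|_{G_{p'}(v^{1-p'})}\},$$ the infimum being taken over all factorizations $h=f\cdot g$ with $f\in L^p(v)$ and $g\in G_{p'}(v^{1-p'})$.
   Context: All functions are real-valued and Lebesgue measurable on $(0,\infty)$; equalities between functions are a.e. A weight is a function $v$ that is positive a.e. and locally integrable on $(0,\infty)$. $\|f\|_{L^p(v)}=\left(\int_0^\infty |f(x)|^p v(x)\,dx\right)^{1/p}$. The weighted Cesàro space $\mathrm{Ces}_p(v)$ is the set of functions $f$ with $$\|f\|_{\mathrm{Ces}_p(v)}=\left(\int_0^\infty\left(\frac1x\int_0^x|f(t)|\,dt\right)^p v(x)\,dx\right)^{1/p}<\infty.$$ For $q>0$ and a weight $u$, $G_q(u)$ is the set of functions $g$ with $$\|g\|_{G_q(u)}=\sup_{t>0}\left(\frac{1}{\int_0^t u(x)\,dx}\int_0^t|g(x)|^q u(x)\,dx\right)^{1/q}<\infty.$$ The class $M_p$ consists of the weights $v$ for which there is a constant $C>0$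 such that, for all $t>0$, $$\left(\int_t^\infty\frac{v(x)}{x^p}\,dx\right)^{1/p}\left(\int_0^t v^{1-p'}(x)\,dx\right)^{1/p'}\le C,$$ and $[v]_{M_p}$ is the least such $C$. The class $m_p$ consists of the weights for which the reverse inequality ($\ge C$ for all $t>0$) holds with some constant $C>0$, and $[v]_{m_p}$ is the largest such $C$. *)

theory Defs
  imports "HOL-Analysis.Analysis"
begin

text \<open>
  Functions on the half-line are functions on \<^typ>\<open>real\<close> of which only the values on
  the positive reals matter. All norms take values in \<^typ>\<open>ennreal\<close>, so that
  ``finite'' is an honest condition.
\<close>

abbreviation half_line :: "real measure" where
  "half_line \<equiv> lebesgue_on {0<..}"

text \<open>Powers of extended nonnegative reals; only used for exponents \<open>a > 0\<close>, whence
  the value \<open>\<infinity>\<close> at \<open>\<infinity>\<close>.\<close>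

definition enn_powr :: "ennreal \<Rightarrow> real \<Rightarrow> ennreal" where
  "enn_powr x a = (if x = \<infinity> then \<infinity> else ennreal (enn2real x powr a))"

text \<open>Local integrability on the open half-line: integrability on its compact subsets
  (integrability near \<open>0\<close> is not required).\<close>

definition weight :: "(real \<Rightarrow> real) \<Rightarrow> bool" where
  "weight v \<longleftrightarrow> v \<in> borel_measurable half_line \<and> (AE x in half_line. v x > 0) \<and>
     (\<forall>K. compact K \<and> K \<subseteq> {0<..} \<longrightarrow> set_integrable lebesgue K v)"

definition Lp_norm :: "real \<Rightarrow> (real \<Rightarrow> real) \<Rightarrow> (real \<Rightarrow> real) \<Rightarrow> ennreal" where
  "Lp_norm p v f =
     enn_powr (\<integral>\<^sup>+x\<in>{0<..}. ennreal (\<bar>f x\<bar> powr p * v x) \<partial>lebesgue) (1 / p)"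

definition Lp_space :: "real \<Rightarrow> (real \<Rightarrow> real) \<Rightarrow> (real \<Rightarrow> real) set" where
  "Lp_space p v = {f \<in> borel_measurable half_line. Lp_norm p v f < \<infinity>}"

definition Ces_norm :: "real \<Rightarrow> (real \<Rightarrow> real) \<Rightarrow> (real \<Rightarrow> real) \<Rightarrow> ennreal" where
  "Ces_norm p v f =
     enn_powr
       (\<integral>\<^sup>+x\<in>{0<..}.
          enn_powr (ennreal (1 / x) * (\<integral>\<^sup>+t\<in>{0<..<x}. ennreal \<bar>f t\<bar> \<partial>lebesgue)) p
            * ennreal (v x) \<partial>lebesgue)
       (1 / p)"

definition Ces :: "real \<Rightarrow> (real \<Rightarrow> real) \<Rightarrow> (real \<Rightarrow> real) set" where
  "Ces p v = {f \<in> borel_measurable half_line. Ces_norm p v f < \<infinity>}"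

definition G_norm :: "real \<Rightarrow> (real \<Rightarrow> real) \<Rightarrow> (real \<Rightarrow> real) \<Rightarrow> ennreal" where
  "G_norm q u g =
     (SUP t\<in>{0<..}.
        enn_powr
          (1 / (\<integral>\<^sup>+x\<in>{0<..<t}. ennreal (u x) \<partial>lebesgue)
             * (\<integral>\<^sup>+x\<in>{0<..<t}. ennreal (\<bar>g x\<bar> powr q * u x) \<partial>lebesgue))
          (1 / q))"

definition G_space :: "real \<Rightarrow> (real \<Rightarrow> real) \<Rightarrow> (real \<Rightarrow> real) set" where
  "G_space q u = {g \<in> borel_measurable half_line. G_norm q u g < \<infinity>}"

definition conj_exp :: "real \<Rightarrow> real" where
  "conj_exp p = p / (p - 1)"

text \<open>The left-hand side of the conditions defining the two classes of weights. For a
  weight both factors are nonzero, so the convention \<open>0 * \<infinity> = 0\<close> plays no role.\<close>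

definition M_expr :: "real \<Rightarrow> (real \<Rightarrow> real) \<Rightarrow> real \<Rightarrow> ennreal" where
  "M_expr p v t =
     enn_powr (\<integral>\<^sup>+x\<in>{t<..}. ennreal (v x / x powr p) \<partial>lebesgue) (1 / p)
     * enn_powr (\<integral>\<^sup>+x\<in>{0<..<t}. ennreal (v x powr (1 - conj_exp p)) \<partial>lebesgue)
         (1 / conj_exp p)"

definition class_M :: "real \<Rightarrow> (real \<Rightarrow> real) set" where
  "class_M p = {v. weight v \<and> (\<exists>C::real. C > 0 \<and> (\<forall>t>0. M_expr p v t \<le> ennreal C))}"

definition class_m :: "real \<Rightarrow> (real \<Rightarrow> real) set" where
  "class_m p = {v. weight v \<and> (\<exists>C::real. C > 0 \<and> (\<forall>t>0. M_expr p v t \<ge> ennreal C))}"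

text \<open>Least, respectively largest, admissible constant. The supremum is taken in
  \<^typ>\<open>ennreal\<close> since the admissible constants for \<open>class_m\<close> may be unbounded
  when \<open>v\<close> is not in \<open>class_M\<close>.\<close>

definition const_M :: "real \<Rightarrow> (real \<Rightarrow> real) \<Rightarrow> ennreal" where
  "const_M p v = (INF C\<in>{C::real. C > 0 \<and> (\<forall>t>0. M_expr p v t \<le> ennreal C)}. ennreal C)"

definition const_m :: "real \<Rightarrow> (real \<Rightarrow> real) \<Rightarrow> ennreal" where
  "const_m p v = (SUP C\<in>{C::real. C > 0 \<and> (\<forall>t>0. M_expr p v t \<ge> ennreal C)}. ennreal C)"

text \<open>Equality of functions on the half-line is equality almost everywhere.\<close>

definition factorizations ::
  "real \<Rightarrow> (real \<Rightarrow> real) \<Rightarrow> (real \<Rightarrow> real) \<Rightarrow> ((real \<Rightarrow> real) \<times> (real \<Rightarrow> real)) set" where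
  "factorizations p v h =
     {(f, g). f \<in> Lp_space p v \<and> g \<in> G_space (conj_exp p) (\<lambda>x. v x powr (1 - conj_exp p)) \<and>
        (AE x in half_line. h x = f x * g x)}"

definition factor_norm :: "real \<Rightarrow> (real \<Rightarrow> real) \<Rightarrow> (real \<Rightarrow> real) \<Rightarrow> ennreal" where
  "factor_norm p v h =
     (INF (f, g)\<in>factorizations p v h.
        Lp_norm p v f * G_norm (conj_exp p) (\<lambda>x. v x powr (1 - conj_exp p)) g)"

end

theory Submission
  imports Defs
begin

text \<open>
  Write \<open>q\<close> for the conjugate exponent of \<open>p\<close>, \<open>u = v\<^sup>1\<^sup>-\<^sup>q\<close>, \<open>w x = v x / x\<^sup>p\<close>, \<open>U t\<close> for the integral of \<open>u\<close>
  up to \<open>t\<close> and \<open>V t\<close> for that of \<open>w\<close> from \<open>t\<close> on. Membership in the two classes of weights means that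
  \<open>V\<^sup>1\<^sup>/\<^sup>p U\<^sup>1\<^sup>/\<^sup>q\<close> is bounded above and below. A factorization \<open>h = f g\<close> is the same as a
  representation \<open>\<bar>h\<bar> = a\<^sup>1\<^sup>/\<^sup>p \<phi>\<^sup>1\<^sup>/\<^sup>q\<close>, with \<open>a = \<bar>f\<bar>\<^sup>p v\<close> and \<open>\<phi> = \<bar>g\<bar>\<^sup>q u\<close>, because the weights cancel. In
  these terms \<open>f\<close> has finite norm if \<open>a\<close> is integrable, and \<open>g\<close> has finite norm if the running integral
  of \<open>\<phi>\<close> is at most a constant times \<open>U\<close>.

  The upper bound for the Cesaro norm of \<open>f g\<close> is Muckenhoupt's form of Hardy's inequality with the
  weights \<open>w\<close> and \<open>\<phi>\<close> (\<open>Hardy_Muckenhoupt\<close>). Its proof needs the integral of \<open>\<phi> \<Phi>\<^sup>-\<^sup>1\<^sup>/\<^sup>p\<close> for the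
  primitive \<open>\<Phi>\<close> of \<open>\<phi>\<close>, and similarly for \<open>w\<close>. A layer-cake computation
  (\<open>nn_integral_cumulative_powr_le\<close>) supplies both without a chain rule for absolutely continuous
  functions.

  For the lower bound, let \<open>H\<close> be the running integral of \<open>\<bar>h\<bar>\<close> and \<open>A\<close> the integral of
  \<open>H\<^sup>p\<^sup>-\<^sup>1 w\<close> from a point on. Then \<open>a = \<bar>h\<bar> A\<close> and \<open>\<phi> = \<bar>h\<bar> A\<^sup>1\<^sup>-\<^sup>q\<close> work
  (\<open>running_average_factorization\<close>): the integral of \<open>a\<close> is exactly the \<open>p\<close>-th power of the Cesaro norm, and
  the running integral of \<open>\<phi>\<close> is at most \<open>V\<^sup>1\<^sup>-\<^sup>q\<close>, which the lower bound on \<open>V\<^sup>1\<^sup>/\<^sup>p U\<^sup>1\<^sup>/\<^sup>q\<close> compares with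
  \<open>U\<close>.
\<close>

section \<open>Powers of extended nonnegative reals\<close>

lemma enn_powr_ennreal: "x \<ge> 0 \<Longrightarrow> enn_powr (ennreal x) a = ennreal (x powr a)"
  by (simp add: enn_powr_def)

lemma enn_powr_top [simp]: "enn_powr top a = top"
  by (simp add: enn_powr_def)

lemma enn_powr_zero [simp]: "enn_powr 0 a = 0"
  by (simp add: enn_powr_def)

lemma enn_powr_one [simp]: "enn_powr x 1 = x"
  by (cases x) (auto simp: enn_powr_def)

lemma enn_powr_less_top_iff [simp]: "enn_powr x a < top \<longleftrightarrow> x < top"
  by (auto simp: enn_powr_def less_top)

lemma enn_powr_pos_iff [simp]: "0 < enn_powr x a \<longleftrightarrow> 0 < x"
  by (cases x) (auto simp: enn_powr_def)

lemma enn_powr_mono: "x \<le> y \<Longrightarrow> a \<ge> 0 \<Longrightarrow> enn_powr x a \<le> enn_powr y a"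
  by (cases x; cases y) (auto simp: enn_powr_def top_unique intro!: powr_mono2)

lemma enn_powr_mult: "a > 0 \<Longrightarrow> enn_powr (x * y) a = enn_powr x a * enn_powr y a"
  by (cases x; cases y)
     (auto simp: enn_powr_def ennreal_mult_top ennreal_top_mult powr_mult
           simp flip: ennreal_mult)

lemma enn_powr_powr: "enn_powr (enn_powr x a) b = enn_powr x (a * b)"
  by (cases x) (auto simp: enn_powr_def powr_powr)

lemma enn_powr_add: "a > 0 \<Longrightarrow> b > 0 \<Longrightarrow> enn_powr x (a + b) = enn_powr x a * enn_powr x b"
  by (cases x) (auto simp: enn_powr_def powr_add ennreal_mult)

lemma borel_measurable_enn_powr [measurable]:
  assumes [measurable]: "f \<in> borel_measurable M"
  shows "(\<lambda>x. enn_powr (f x) a) \<in> borel_measurable M"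
  unfolding enn_powr_def infinity_ennreal_def by measurable

section \<open>Hoelder's inequality\<close>

lemma weighted_AM_GM:
  fixes x y :: real
  assumes "p > 1" "q > 1" "1/p + 1/q = 1" "x \<ge> 0" "y \<ge> 0"
  shows "x powr (1/p) * y powr (1/q) \<le> x / p + y / q"
  using Youngs_inequality[of p q "x powr (1/p)" "y powr (1/q)"] assms
  by (simp add: powr_powr)

text \<open>
  The usual proof by normalisation: after dividing \<open>a\<close> and \<open>b\<close> by their integrals, integrate the
  weighted arithmetic-geometric mean inequality. Writing the integrand as a product of powers of two
  integrable functions matches the factorizations below, where the factors are given by
  \<open>a = \<bar>f\<bar>\<^sup>p v\<close> and \<open>b = \<bar>g\<bar>\<^sup>q u\<close>.
\<close>

lemma Holder_nn_integral:
  fixes a b :: "'a \<Rightarrow> real"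
  assumes [measurable]: "a \<in> borel_measurable M" "b \<in> borel_measurable M"
    and nonneg: "\<And>x. x \<in> space M \<Longrightarrow> 0 \<le> a x" "\<And>x. x \<in> space M \<Longrightarrow> 0 \<le> b x"
    and pq: "p > 1" "q > 1" "1/p + 1/q = 1"
  shows "(\<integral>\<^sup>+x. ennreal (a x powr (1/p) * b x powr (1/q)) \<partial>M)
    \<le> enn_powr (\<integral>\<^sup>+x. ennreal (a x) \<partial>M) (1/p) * enn_powr (\<integral>\<^sup>+x. ennreal (b x) \<partial>M) (1/q)"
    (is "?I \<le> enn_powr ?A _ * enn_powr ?B _")
proof -
  consider "?A = 0 \<or> ?B = 0" | "?A \<noteq> 0" "?B \<noteq> 0" "?A = top \<or> ?B = top"
    | A B where "?A = ennreal A" "?B = ennreal B" "A > 0" "B > 0"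
    by (cases ?A; cases ?B) (force simp: less_le)+
  then show ?thesis
  proof cases
    case 1
    then have "AE x in M. ennreal (a x powr (1/p) * b x powr (1/q)) = 0"
    proof
      assume "?A = 0"
      then have "AE x in M. ennreal (a x) = 0" by (subst (asm) nn_integral_0_iff_AE) auto
      then show ?thesis using AE_space
      proof eventually_elim
        case (elim x)
        then have "a x = 0" using nonneg(1)[of x] by (simp add: ennreal_eq_0_iff)
        then show ?case by simp
      qed
    next
      assume "?B = 0"
      then have "AE x in M. ennreal (b x) = 0" by (subst (asm) nn_integral_0_iff_AE) auto
      then show ?thesis using AE_space
      proof eventually_elim
        case (elim x)
        then have "b x = 0" using nonneg(2)[of x] by (simp add: ennreal_eq_0_iff)
        then show ?case by simp
      qed
    qed
    then have "?I = 0" by (subst nn_integral_0_iff_AE) auto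
    then show ?thesis by simp
  next
    case 2
    then have "enn_powr ?A (1/p) * enn_powr ?B (1/q) = top"
      by (metis enn_powr_pos_iff enn_powr_top ennreal_mult_eq_top_iff not_gr_zero zero_less_iff_neq_zero)
    then show ?thesis by simp
  next
    case (3 A B)
    let ?c = "A powr (1/p) * B powr (1/q)"
    have "?I \<le> (\<integral>\<^sup>+x. ennreal ?c * (ennreal (1/(p*A)) * ennreal (a x) + ennreal (1/(q*B)) * ennreal (b x)) \<partial>M)"
    proof (rule nn_integral_mono)
      fix x assume x: "x \<in> space M"
      have "(a x / A) powr (1/p) * (b x / B) powr (1/q) \<le> (a x / A) / p + (b x / B) / q"
        using nonneg[OF x] 3 pq by (intro weighted_AM_GM) auto
      also have "(a x / A) powr (1/p) * (b x / B) powr (1/q) = (a x powr (1/p) * b x powr (1/q)) / ?c"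
        using nonneg[OF x] 3 by (simp add: powr_divide)
      finally have "a x powr (1/p) * b x powr (1/q) \<le> ?c * (1/(p*A) * a x + 1/(q*B) * b x)"
        using 3 by (simp add: field_simps)
      then show "ennreal (a x powr (1/p) * b x powr (1/q)) \<le>
         ennreal ?c * (ennreal (1/(p*A)) * ennreal (a x) + ennreal (1/(q*B)) * ennreal (b x))"
        using nonneg[OF x] 3 pq by (simp flip: ennreal_mult ennreal_plus)
    qed
    also have "\<dots> = ennreal ?c * (ennreal (1/(p*A)) * ?A + ennreal (1/(q*B)) * ?B)"
      by (subst nn_integral_cmult; simp add: nn_integral_add nn_integral_cmult)
    also have "\<dots> = ennreal (?c * (1/p + 1/q))"
      using 3 pq by (simp flip: ennreal_mult ennreal_plus add: field_simps)
    also have "\<dots> = enn_powr ?A (1/p) * enn_powr ?B (1/q)"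
      using 3 pq by (simp add: enn_powr_ennreal ennreal_mult)
    finally show ?thesis .
  qed
qed

section \<open>Integrating powers of cumulative masses\<close>

text \<open>
  A set \<open>S\<close> that is downward closed for the height \<open>e\<close> is either a closed sublevel set, with a highest
  point in \<open>S\<close>, or an increasing union of sublevel sets with rational heights, each of which lies
  below some point of \<open>S\<close>. The height is a parameter so that the choices \<open>e x = x\<close> and \<open>e x = - x\<close>
  serve the integrals over initial and over final rays alike.
\<close>

lemma emeasure_sublevel_set_le:
  fixes e :: "'a \<Rightarrow> real"
  assumes [measurable]: "e \<in> borel_measurable M"
    and sub: "S \<subseteq> space M"
    and closed: "\<And>x y. y \<in> S \<Longrightarrow> x \<in> space M \<Longrightarrow> e x \<le> e y \<Longrightarrow> x \<in> S"
    and le: "\<And>y. y \<in> S \<Longrightarrow> emeasure M {x\<in>space M. e x \<le> e y} \<le> s"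
  shows "S \<in> sets M \<and> emeasure M S \<le> s"
proof (cases "\<exists>m\<in>S. \<forall>y\<in>S. e y \<le> e m")
  case True
  then obtain m where m: "m \<in> S" "\<forall>y\<in>S. e y \<le> e m" by blast
  then have "S = {x\<in>space M. e x \<le> e m}" using sub closed by blast
  then show ?thesis using le[OF m(1)] by auto
next
  case no_max: False
  show ?thesis
  proof (cases "S = {}")
    case False
    define Q where "Q = {r \<in> \<rat>. \<exists>y\<in>S. r \<le> e y}"
    define r where "r = from_nat_into Q"
    have between: "\<exists>r\<in>Q. e x \<le> r" if x: "x \<in> S" for x
    proof -
      obtain y where y: "y \<in> S" "e x < e y" using no_max x by force
      then obtain r where "r \<in> \<rat>" "e x < r" "r < e y" using Rats_dense_in_real by blast
      then show ?thesis using y unfolding Q_def by force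
    qed
    have "countable Q" unfolding Q_def
      by (rule countable_subset[OF _ countable_rat]) auto
    moreover have "Q \<noteq> {}" using False between by blast
    ultimately have r: "range r = Q"
      unfolding r_def by (simp add: range_from_nat_into)
    define T where "T n = {x\<in>space M. \<exists>i\<le>n. e x \<le> r i}" for n :: nat
    have S: "S = (\<Union>n. T n)"
    proof (intro equalityI subsetI)
      fix x assume x: "x \<in> S"
      then obtain i where "e x \<le> r i" using between r by (metis rangeE)
      then show "x \<in> (\<Union>n. T n)" using x sub by (auto simp: T_def)
    next
      fix x assume "x \<in> (\<Union>n. T n)"
      then obtain i where x: "x \<in> space M" "e x \<le> r i" by (auto simp: T_def)
      then obtain y where "y \<in> S" "r i \<le> e y" using r unfolding Q_def by blast
      then show "x \<in> S" using closed x by force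
    qed
    have [measurable]: "T n \<in> sets M" for n unfolding T_def by measurable
    have "emeasure M (T n) \<le> s" for n
    proof -
      obtain j where j: "\<forall>i\<le>n. r i \<le> r j"
      proof -
        have "Max (r ` {..n}) \<in> r ` {..n}" by (intro Max_in) auto
        then obtain j where "Max (r ` {..n}) = r j" by blast
        moreover have "\<forall>i\<le>n. r i \<le> Max (r ` {..n})" by (auto intro: Max_ge)
        ultimately show ?thesis using that by metis
      qed
      obtain y where y: "y \<in> S" "r j \<le> e y" using r unfolding Q_def by blast
      have "emeasure M (T n) \<le> emeasure M {x\<in>space M. e x \<le> e y}"
        using j y by (intro emeasure_mono) (force simp: T_def)+
      also have "\<dots> \<le> s" using le y by blast
      finally show ?thesis .
    qed
    moreover have "incseq T" unfolding incseq_def T_def by (blast intro: order_trans)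
    ultimately have "emeasure M (\<Union>n. T n) \<le> s"
      by (subst SUP_emeasure_incseq[symmetric]) (auto intro: SUP_least)
    then show ?thesis unfolding S by auto
  qed auto
qed

lemma nn_integral_powr_atLeast:
  fixes c a :: real
  assumes "c > 0" "a > 0"
  shows "(\<integral>\<^sup>+s. ennreal (s powr (-a-1)) * indicator {c..} s \<partial>lborel) = ennreal (c powr (-a) / a)"
  using nn_integral_has_integral_lebesgue'[OF _ has_integral_powr_to_inf[of "-a-1" c]] assms
  by simp

lemma nn_integral_powr_from_0:
  fixes c a :: real
  assumes "c \<ge> 0" "a < 1"
  shows "(\<integral>\<^sup>+s. ennreal (s powr (-a)) * indicator {0..c} s \<partial>lborel) = ennreal (c powr (1-a) / (1-a))"
  using nn_integral_has_integral_lebesgue'[OF _ has_integral_powr_from_0[of "-a" c]] assms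
  by (simp add: add.commute)

text \<open>
  For a density \<open>k\<close> on the line, the integral of \<open>k K\<^sup>-\<^sup>a\<close> with \<open>K\<close> the primitive of \<open>k\<close> is
  \<open>K\<^sup>1\<^sup>-\<^sup>a / (1 - a)\<close> by the chain rule. This version needs no differentiation: the points whose
  cumulative mass \<open>C\<close> is at most \<open>s\<close> form a set of mass at most \<open>s\<close>, and also at most the total mass
  \<open>L\<close>. Inserting \<open>min s L\<close> into the layer-cake formula for the integral of \<open>C\<^sup>-\<^sup>a\<close>, which
  reads \<open>\<integral> a s\<^sup>-\<^sup>a\<^sup>-\<^sup>1 \<mu>{C \<le> s} ds\<close>, gives the bound. The sublevel sets are closed, so that an atom counts
  towards its own cumulative mass; otherwise a small mass in front of a large atom would break the bound.
\<close>

lemma (in finite_measure) nn_integral_cumulative_powr_le: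
  fixes e :: "'a \<Rightarrow> real" and a :: real
  assumes [measurable]: "e \<in> borel_measurable M" and a: "0 < a" "a < 1"
  shows "(\<integral>\<^sup>+y. ennreal (measure M {x\<in>space M. e x \<le> e y} powr (-a)) \<partial>M)
    \<le> ennreal (measure M (space M) powr (1-a) / (1-a))"
proof -
  define F where "F r = measure M {x\<in>space M. e x \<le> r}" for r
  define C where "C y = F (e y)" for y
  define L where "L = measure M (space M)"
  have "mono F" unfolding F_def by (intro monoI finite_measure_mono) auto
  then have [measurable]: "F \<in> borel_measurable borel" by (rule borel_measurable_mono)
  have [measurable]: "C \<in> borel_measurable M" unfolding C_def by measurable
  have C0: "C y \<ge> 0" for y by (simp add: C_def F_def)
  have L0: "L \<ge> 0" by (simp add: L_def)
  show ?thesis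
  proof (cases "L = 0")
    case True
    then have "AE y in M. False"
      unfolding L_def by (intro AE_I[of _ _ "space M"]) (auto simp: emeasure_eq_measure)
    then have "AE y in M. ennreal (measure M {x\<in>space M. e x \<le> e y} powr (-a)) = 0"
      by eventually_elim simp
    then have "(\<integral>\<^sup>+y. ennreal (measure M {x\<in>space M. e x \<le> e y} powr (-a)) \<partial>M) = (\<integral>\<^sup>+y. 0 \<partial>M)"
      by (rule nn_integral_cong_AE)
    then show ?thesis by simp
  next
    case False
    with L0 have L: "L > 0" by simp
    have sub: "emeasure M {y\<in>space M. C y \<le> s} \<le> ennreal s" for s
    proof -
      have "{y\<in>space M. C y \<le> s} \<in> sets M \<and> emeasure M {y\<in>space M. C y \<le> s} \<le> ennreal s"
      proof (rule emeasure_sublevel_set_le[where e = e])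
        fix x y assume y: "y \<in> {y\<in>space M. C y \<le> s}" and x: "x \<in> space M" "e x \<le> e y"
        then have "C x \<le> C y" unfolding C_def using \<open>mono F\<close> by (auto dest: monoD)
        with x y show "x \<in> {y\<in>space M. C y \<le> s}" by auto
      next
        fix y assume "y \<in> {y\<in>space M. C y \<le> s}"
        then show "emeasure M {x\<in>space M. e x \<le> e y} \<le> ennreal s"
          by (auto simp: emeasure_eq_measure C_def F_def intro!: ennreal_leI)
      qed auto
      then show ?thesis ..
    qed
    have subL: "emeasure M {y\<in>space M. C y \<le> s} \<le> ennreal L" for s
      by (auto simp: emeasure_eq_measure L_def intro!: finite_measure_mono)
    interpret pair_sigma_finite M lborel ..
    \<comment> \<open>layer cake: \<open>C\<^sup>-\<^sup>a\<close> is the integral of \<open>a s\<^sup>-\<^sup>a\<^sup>-\<^sup>1\<close> over \<open>s \<ge> C\<close>\<close>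
    let ?f = "\<lambda>y s. ennreal (a * s powr (-a-1)) * indicator {z. C y \<le> z} s"
    have "(\<integral>\<^sup>+y. ennreal (C y powr (-a)) \<partial>M) \<le> (\<integral>\<^sup>+y. (\<integral>\<^sup>+s. ?f y s \<partial>lborel) \<partial>M)"
    proof (rule nn_integral_mono)
      fix y
      \<comment> \<open>only an inequality, since \<open>0 powr (-a) = 0\<close> where \<open>C\<close> vanishes\<close>
      show "ennreal (C y powr (-a)) \<le> (\<integral>\<^sup>+s. ?f y s \<partial>lborel)"
      proof (cases "C y = 0")
        case False
        then have "C y > 0" using C0[of y] by simp
        then have "ennreal (C y powr (-a)) = ennreal a * (\<integral>\<^sup>+s. ennreal (s powr (-a-1)) * indicator {C y..} s \<partial>lborel)"
          using a by (subst nn_integral_powr_atLeast) (auto simp flip: ennreal_mult)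
        also have "\<dots> = (\<integral>\<^sup>+s. ?f y s \<partial>lborel)"
          using a by (subst nn_integral_cmult[symmetric])
             (auto simp: ennreal_mult atLeast_def mult.assoc intro!: nn_integral_cong)
        finally show ?thesis by simp
      qed simp
    qed
    also have "\<dots> = (\<integral>\<^sup>+s. (\<integral>\<^sup>+y. ?f y s \<partial>M) \<partial>lborel)"
      by (rule Fubini'[symmetric]) measurable
    also have "\<dots> = (\<integral>\<^sup>+s. ennreal (a * s powr (-a-1)) * emeasure M {y\<in>space M. C y \<le> s} \<partial>lborel)"
    proof (rule nn_integral_cong)
      fix s
      have "(\<integral>\<^sup>+y. ?f y s \<partial>M) = (\<integral>\<^sup>+y. ennreal (a * s powr (-a-1)) * indicator {y\<in>space M. C y \<le> s} y \<partial>M)"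
        by (intro nn_integral_cong) (auto simp: indicator_def)
      then show "(\<integral>\<^sup>+y. ?f y s \<partial>M) = ennreal (a * s powr (-a-1)) * emeasure M {y\<in>space M. C y \<le> s}"
        by (simp add: nn_integral_cmult_indicator)
    qed
    also have "\<dots> \<le> (\<integral>\<^sup>+s. ennreal a * (ennreal (s powr (-a)) * indicator {0..L} s)
         + ennreal (a * L) * (ennreal (s powr (-a-1)) * indicator {L..} s) \<partial>lborel)"
    proof (rule nn_integral_mono)
      fix s :: real
      consider "s \<le> 0" | "0 < s" "s \<le> L" | "s > L" by linarith
      then show "ennreal (a * s powr (-a-1)) * emeasure M {y\<in>space M. C y \<le> s} \<le>
         ennreal a * (ennreal (s powr (-a)) * indicator {0..L} s)
         + ennreal (a * L) * (ennreal (s powr (-a-1)) * indicator {L..} s)"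
      proof cases
        case 1
        then have "emeasure M {y\<in>space M. C y \<le> s} \<le> 0" using sub[of s] by (simp add: ennreal_neg)
        then show ?thesis by simp
      next
        case 2
        have "ennreal (a * s powr (-a-1)) * emeasure M {y\<in>space M. C y \<le> s} \<le> ennreal (a * s powr (-a-1)) * ennreal s"
          by (intro mult_left_mono sub) auto
        also have "\<dots> = ennreal (a * s powr (-a))"
          using 2 a by (simp add: powr_diff flip: ennreal_mult)
        finally show ?thesis using 2 a by (simp add: ennreal_mult add_increasing2)
      next
        case 3
        have "ennreal (a * s powr (-a-1)) * emeasure M {y\<in>space M. C y \<le> s} \<le> ennreal (a * s powr (-a-1)) * ennreal L"
          by (intro mult_left_mono subL) auto
        also have "\<dots> = ennreal (a * L) * ennreal (s powr (-a-1))"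
          using 3 L a by (simp flip: ennreal_mult add: mult_ac)
        finally show ?thesis using 3 a by simp
      qed
    qed
    also have "\<dots> = ennreal a * ennreal (L powr (1-a) / (1-a)) + ennreal (a * L) * ennreal (L powr (-a) / a)"
      using L a by (simp add: nn_integral_add nn_integral_cmult nn_integral_powr_from_0 nn_integral_powr_atLeast)
    also have "\<dots> = ennreal (a * (L powr (1-a) / (1-a)) + (a * L) * (L powr (-a) / a))"
      using L a by (simp flip: ennreal_mult ennreal_plus)
    also have "a * (L powr (1-a) / (1-a)) + (a * L) * (L powr (-a) / a) = L powr (1-a) / (1-a)"
    proof -
      have "L * L powr (-a) = L powr (1-a)" using L by (simp add: powr_diff powr_minus divide_inverse)
      then have "(a * L) * (L powr (-a) / a) = L powr (1-a)" using a by simp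
      then show ?thesis using a by (simp add: field_simps)
    qed
    finally show ?thesis unfolding C_def F_def L_def .
  qed
qed

text \<open>
  The set where the running integral \<open>K\<close> vanishes is downward closed and all sublevel sets of its
  points have mass \<open>0\<close> for the measure with density \<open>k\<close>; hence so has the set itself.
\<close>

lemma AE_running_integral_pos:
  fixes e :: "'a \<Rightarrow> real" and k :: "'a \<Rightarrow> ennreal"
  assumes [measurable]: "e \<in> borel_measurable M" "k \<in> borel_measurable M"
  shows "AE t in M. k t \<noteq> 0 \<longrightarrow> (\<integral>\<^sup>+s. k s * indicator {s. e s \<le> e t} s \<partial>M) \<noteq> 0"
proof -
  define K where "K t = (\<integral>\<^sup>+s. k s * indicator {s. e s \<le> e t} s \<partial>M)" for t
  define S where "S = {t\<in>space M. K t = 0}"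
  have [measurable]: "e \<in> borel_measurable (density M k)" by measurable
  have K: "emeasure (density M k) {x\<in>space (density M k). e x \<le> e y} = K y" for y
    by (subst emeasure_density) (auto simp: K_def indicator_def intro!: nn_integral_cong)
  have "S \<in> sets (density M k) \<and> emeasure (density M k) S \<le> 0"
  proof (rule emeasure_sublevel_set_le[where e = e])
    show "S \<subseteq> space (density M k)" by (auto simp: S_def)
    fix y assume y: "y \<in> S"
    then show "emeasure (density M k) {x\<in>space (density M k). e x \<le> e y} \<le> 0"
      unfolding K by (simp add: S_def)
    fix x assume x: "x \<in> space (density M k)" "e x \<le> e y"
    have "K x \<le> K y" unfolding K_def using x
      by (intro nn_integral_mono) (auto simp: indicator_def)
    then show "x \<in> S" using x y by (simp add: S_def)
  qed measurable
  then have [measurable]: "S \<in> sets M" and "emeasure (density M k) S = 0" by auto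
  then have "(\<integral>\<^sup>+s. k s * indicator S s \<partial>M) = 0" by (simp add: emeasure_density)
  then have "AE s in M. k s * indicator S s = 0" by (subst (asm) nn_integral_0_iff_AE) auto
  then show ?thesis using AE_space
    by eventually_elim (auto simp: S_def K_def indicator_def split: if_splits)
qed

text \<open>
  The bound for cumulative masses, applied to the measure with density \<open>k\<close> cut off above the height
  of \<open>x\<close>: below that height its cumulative masses are the values of \<open>K\<close>.
\<close>

lemma nn_integral_running_integral_powr_le:
  fixes e k K :: "'a \<Rightarrow> real" and a :: real
  assumes [measurable]: "e \<in> borel_measurable M" "k \<in> borel_measurable M"
    and k: "\<And>t. t \<in> space M \<Longrightarrow> 0 \<le> k t" and K: "\<And>t. t \<in> space M \<Longrightarrow> 0 \<le> K t"
    and eq: "\<And>t. t \<in> space M \<Longrightarrow> (\<integral>\<^sup>+s. ennreal (k s) * indicator {s. e s \<le> e t} s \<partial>M) = ennreal (K t)"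
    and [measurable]: "K \<in> borel_measurable M"
    and a: "0 < a" "a < 1" and x: "x \<in> space M"
  shows "(\<integral>\<^sup>+t. ennreal (k t * K t powr (-a)) * indicator {t. e t \<le> e x} t \<partial>M)
    \<le> ennreal (K x powr (1-a) / (1-a))"
proof -
  define N where "N = density M (\<lambda>t. ennreal (k t) * indicator {t. e t \<le> e x} t)"
  have [measurable]: "e \<in> borel_measurable N" unfolding N_def by measurable
  have sp: "space N = space M" by (simp add: N_def)
  have N: "emeasure N {s\<in>space N. e s \<le> e y} = ennreal (K y)" if "y \<in> space M" "e y \<le> e x" for y
  proof -
    have "emeasure N {s\<in>space N. e s \<le> e y} = (\<integral>\<^sup>+s. ennreal (k s) * indicator {s. e s \<le> e y} s \<partial>M)"
      unfolding N_def using that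
      by (subst emeasure_density) (auto simp: indicator_def intro!: nn_integral_cong)
    then show ?thesis using eq[OF that(1)] by simp
  qed
  have tot: "emeasure N (space N) = ennreal (K x)"
  proof -
    have "emeasure N (space N) = (\<integral>\<^sup>+s. ennreal (k s) * indicator {s. e s \<le> e x} s \<partial>M)"
      unfolding N_def
      by (subst emeasure_density) (auto simp: indicator_def intro!: nn_integral_cong)
    then show ?thesis using eq[OF x] by simp
  qed
  interpret N: finite_measure N by standard (simp add: tot)
  have "(\<integral>\<^sup>+t. ennreal (k t * K t powr (-a)) * indicator {t. e t \<le> e x} t \<partial>M)
      = (\<integral>\<^sup>+t. (ennreal (k t) * indicator {t. e t \<le> e x} t) * ennreal (K t powr (-a)) \<partial>M)"
    using k by (intro nn_integral_cong) (auto simp: ennreal_mult indicator_def)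
  also have "\<dots> = (\<integral>\<^sup>+t. (ennreal (k t) * indicator {t. e t \<le> e x} t)
                     * ennreal (measure N {s\<in>space N. e s \<le> e t} powr (-a)) \<partial>M)"
    using N K by (intro nn_integral_cong) (auto simp: indicator_def measure_def)
  also have "\<dots> = (\<integral>\<^sup>+t. ennreal (measure N {s\<in>space N. e s \<le> e t} powr (-a)) \<partial>N)"
  proof -
    have dens: "(\<integral>\<^sup>+t. G t \<partial>N) = (\<integral>\<^sup>+t. (ennreal (k t) * indicator {t. e t \<le> e x} t) * G t \<partial>M)"
      if "G \<in> borel_measurable M" for G
      unfolding N_def using that by (subst nn_integral_density) auto
    have "mono (\<lambda>r. measure N {s\<in>space N. e s \<le> r})"
      by (intro monoI N.finite_measure_mono) auto
    then have [measurable]: "(\<lambda>r. measure N {s\<in>space N. e s \<le> r}) \<in> borel_measurable borel"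
      by (rule borel_measurable_mono)
    show ?thesis
      by (rule dens[symmetric])
         (rule measurable_compose[where N = borel and f = e], measurable)
  qed
  also have "\<dots> \<le> ennreal (measure N (space N) powr (1-a) / (1-a))"
    by (rule N.nn_integral_cumulative_powr_le) (use a in auto)
  also have "measure N (space N) = K x" using tot K[OF x] by (simp add: measure_def)
  finally show ?thesis .
qed

section \<open>Running integrals on the line\<close>

lemma borel_measurable_indicator_ray:
  fixes x :: real
  assumes "(\<lambda>x. x) \<in> borel_measurable M"
  shows "(indicator {..x} :: real \<Rightarrow> 'b::{zero_neq_one,topological_space}) \<in> borel_measurable M"
    and "(indicator {x..} :: real \<Rightarrow> 'b) \<in> borel_measurable M"
proof -
  note [measurable] = assms
  show "(indicator {..x} :: real \<Rightarrow> 'b) \<in> borel_measurable M"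
    by (rule borel_measurable_indicator') (simp, measurable)
  show "(indicator {x..} :: real \<Rightarrow> 'b) \<in> borel_measurable M"
    by (rule borel_measurable_indicator') (simp, measurable)
qed

lemma nn_integral_triangle_swap:
  fixes M :: "real measure" and f g :: "real \<Rightarrow> ennreal"
  assumes "sigma_finite_measure M" and id: "(\<lambda>x. x) \<in> borel_measurable M"
    and [measurable]: "f \<in> borel_measurable M" "g \<in> borel_measurable M"
  shows "(\<integral>\<^sup>+x. (\<integral>\<^sup>+t. f t * indicator {..x} t \<partial>M) * g x \<partial>M)
       = (\<integral>\<^sup>+t. f t * (\<integral>\<^sup>+x. g x * indicator {t..} x \<partial>M) \<partial>M)"
proof -
  note [measurable] = id borel_measurable_indicator_ray[OF id]
  interpret sigma_finite_measure M by fact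
  interpret P: pair_sigma_finite M M ..
  have "(\<integral>\<^sup>+x. (\<integral>\<^sup>+t. f t * indicator {..x} t \<partial>M) * g x \<partial>M)
      = (\<integral>\<^sup>+x. (\<integral>\<^sup>+t. f t * g x * indicator {p. snd p \<le> fst p} (x, t) \<partial>M) \<partial>M)"
    by (subst nn_integral_multc[symmetric])
       (auto intro!: nn_integral_cong simp: indicator_def)
  also have "\<dots> = (\<integral>\<^sup>+t. (\<integral>\<^sup>+x. f t * g x * indicator {p. snd p \<le> fst p} (x, t) \<partial>M) \<partial>M)"
    by (rule P.Fubini'[symmetric]) (simp add: indicator_def, measurable)
  also have "\<dots> = (\<integral>\<^sup>+t. f t * (\<integral>\<^sup>+x. g x * indicator {t..} x \<partial>M) \<partial>M)"
    by (subst nn_integral_cmult[symmetric])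
       (auto intro!: nn_integral_cong simp: indicator_def)
  finally show ?thesis .
qed

lemma borel_measurable_running_integral:
  fixes f :: "real \<Rightarrow> ennreal"
  assumes "sigma_finite_measure M" and id [measurable]: "(\<lambda>x. x) \<in> borel_measurable M"
    and [measurable]: "f \<in> borel_measurable M"
  shows "(\<lambda>x. \<integral>\<^sup>+t. f t * indicator {..x} t \<partial>M) \<in> borel_measurable M"
    and "(\<lambda>x. \<integral>\<^sup>+t. f t * indicator {x..} t \<partial>M) \<in> borel_measurable M"
proof -
  interpret sigma_finite_measure M by fact
  show "(\<lambda>x. \<integral>\<^sup>+t. f t * indicator {..x} t \<partial>M) \<in> borel_measurable M"
    and "(\<lambda>x. \<integral>\<^sup>+t. f t * indicator {x..} t \<partial>M) \<in> borel_measurable M"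
    unfolding indicator_def atMost_iff atLeast_iff by measurable
qed

section \<open>Hardy's inequality with two weights\<close>

text \<open>
  Muckenhoupt's argument. Splitting \<open>a\<^sup>1\<^sup>/\<^sup>p \<phi>\<^sup>1\<^sup>/\<^sup>q\<close> as
  \<open>(a \<Phi>\<^sup>1\<^sup>/\<^sup>q)\<^sup>1\<^sup>/\<^sup>p (\<phi> \<Phi>\<^sup>-\<^sup>1\<^sup>/\<^sup>p)\<^sup>1\<^sup>/\<^sup>q\<close>, Hoelder's inequality leaves the integral of
  \<open>\<phi> \<Phi>\<^sup>-\<^sup>1\<^sup>/\<^sup>p\<close>, which is at most \<open>q \<Phi>\<^sup>1\<^sup>/\<^sup>q\<close> since \<open>\<Phi>\<close> is the primitive of \<open>\<phi>\<close>. The hypothesis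
  on \<open>B\<close> turns that power of \<open>\<Phi>\<close> into the power \<open>V\<^sup>-\<^sup>1\<^sup>/\<^sup>q\<close>. After exchanging the integrals, the
  integral of \<open>w V\<^sup>-\<^sup>1\<^sup>/\<^sup>q\<close> is bounded by \<open>p V\<^sup>1\<^sup>/\<^sup>p\<close> in the same way, and the remaining product
  \<open>\<Phi>\<^sup>1\<^sup>/\<^sup>q V\<^sup>1\<^sup>/\<^sup>p\<close> is again at most \<open>B\<close>.
\<close>

lemma Hardy_Muckenhoupt:
  fixes M :: "real measure" and a \<phi> w \<Phi> V :: "real \<Rightarrow> real" and p q B :: real
  assumes sf: "sigma_finite_measure M" and id [measurable]: "(\<lambda>x. x) \<in> borel_measurable M"
    and [measurable]: "a \<in> borel_measurable M" "\<phi> \<in> borel_measurable M" "w \<in> borel_measurable M"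
    and nonneg: "\<And>x. x \<in> space M \<Longrightarrow> 0 \<le> a x" "\<And>x. x \<in> space M \<Longrightarrow> 0 \<le> \<phi> x"
      "\<And>x. x \<in> space M \<Longrightarrow> 0 \<le> w x"
    and pq: "p > 1" "q > 1" "1/p + 1/q = 1"
    and \<Phi>: "\<And>t. t \<in> space M \<Longrightarrow> (\<integral>\<^sup>+s. ennreal (\<phi> s) * indicator {..t} s \<partial>M) = ennreal (\<Phi> t)"
      "\<And>t. t \<in> space M \<Longrightarrow> 0 \<le> \<Phi> t"
    and V: "\<And>t. t \<in> space M \<Longrightarrow> (\<integral>\<^sup>+x. ennreal (w x) * indicator {t..} x \<partial>M) = ennreal (V t)"
      "\<And>t. t \<in> space M \<Longrightarrow> 0 < V t"
    and B: "B \<ge> 0" "\<And>t. t \<in> space M \<Longrightarrow> V t powr (1/p) * \<Phi> t powr (1/q) \<le> B"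
  shows "(\<integral>\<^sup>+x. enn_powr (\<integral>\<^sup>+t. ennreal (a t powr (1/p) * \<phi> t powr (1/q)) * indicator {..x} t \<partial>M) p
             * ennreal (w x) \<partial>M)
    \<le> ennreal (q powr (p/q) * p * B powr p) * (\<integral>\<^sup>+t. ennreal (a t) \<partial>M)"
proof -
  note [measurable] = borel_measurable_indicator_ray[OF id]
  have pq': "1 - 1/p = 1/q" "1 - 1/q = 1/p" "p/q = p - 1"
    using pq by (auto simp: field_simps)
  have \<Phi>m [measurable]: "\<Phi> \<in> borel_measurable M"
  proof -
    have "(\<lambda>t. enn2real (\<integral>\<^sup>+s. ennreal (\<phi> s) * indicator {..t} s \<partial>M)) \<in> borel_measurable M"
      using borel_measurable_running_integral(1)[OF sf id, of "\<lambda>s. ennreal (\<phi> s)"] by measurable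
    then show ?thesis
      by (rule measurable_cong[THEN iffD1, rotated]) (simp add: \<Phi>)
  qed
  have Vm [measurable]: "V \<in> borel_measurable M"
  proof -
    have "(\<lambda>t. enn2real (\<integral>\<^sup>+s. ennreal (w s) * indicator {t..} s \<partial>M)) \<in> borel_measurable M"
      using borel_measurable_running_integral(2)[OF sf id, of "\<lambda>s. ennreal (w s)"] by measurable
    then show ?thesis
      by (rule measurable_cong[THEN iffD1, rotated]) (simp add: V less_imp_le)
  qed
  have \<Phi>_int: "(\<integral>\<^sup>+t. ennreal (\<phi> t * \<Phi> t powr (-1/p)) * indicator {..x} t \<partial>M) \<le> ennreal (q * \<Phi> x powr (1/q))"
    if x: "x \<in> space M" for x
    using nn_integral_running_integral_powr_le[of "\<lambda>x. x" M \<phi> \<Phi> "1/p" x] nonneg \<Phi> pq pq' x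
    by (simp add: atMost_def mult.commute)
  have V_int: "(\<integral>\<^sup>+x. ennreal (w x * V x powr (-1/q)) * indicator {t..} x \<partial>M) \<le> ennreal (p * V t powr (1/p))"
    if t: "t \<in> space M" for t
    using nn_integral_running_integral_powr_le[of "\<lambda>x. -x" M w V "1/q" t] nonneg V pq pq' t
    by (simp add: atLeast_def mult.commute less_imp_le)
  have \<Phi>_pos: "AE t in M. \<phi> t \<noteq> 0 \<longrightarrow> \<Phi> t > 0"
  proof -
    have "AE t in M. ennreal (\<phi> t) \<noteq> 0 \<longrightarrow> (\<integral>\<^sup>+s. ennreal (\<phi> s) * indicator {s. s \<le> t} s \<partial>M) \<noteq> 0"
      by (rule AE_running_integral_pos) measurable
    then show ?thesis using AE_space
    proof eventually_elim
    case (elim t)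
    then show ?case using \<Phi>[of t] nonneg(2)[of t] by (auto simp: atMost_def less_le ennreal_eq_0_iff)
    qed
  qed
  define J where "J x = (\<integral>\<^sup>+t. ennreal (a t * \<Phi> t powr (1/q)) * indicator {..x} t \<partial>M)" for x
  have ptw: "enn_powr (\<integral>\<^sup>+t. ennreal (a t powr (1/p) * \<phi> t powr (1/q)) * indicator {..x} t \<partial>M) p * ennreal (w x)
     \<le> ennreal (q powr (p/q) * B powr (p/q)) * (J x * ennreal (w x * V x powr (-1/q)))"
    if x: "x \<in> space M" for x
  proof -
    let ?a = "\<lambda>t. a t * \<Phi> t powr (1/q) * indicator {..x} t"
    let ?b = "\<lambda>t. \<phi> t * \<Phi> t powr (-1/p) * indicator {..x} t"
    have "(\<integral>\<^sup>+t. ennreal (a t powr (1/p) * \<phi> t powr (1/q)) * indicator {..x} t \<partial>M)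
       \<le> (\<integral>\<^sup>+t. ennreal (?a t powr (1/p) * ?b t powr (1/q)) \<partial>M)"
    proof (rule nn_integral_mono_AE)
      show "AE t in M. ennreal (a t powr (1/p) * \<phi> t powr (1/q)) * indicator {..x} t
          \<le> ennreal (?a t powr (1/p) * ?b t powr (1/q))"
        using \<Phi>_pos AE_space
      proof eventually_elim
        case (elim t)
        show ?case
        proof (cases "t \<le> x \<and> \<phi> t \<noteq> 0")
          case True
          then have "\<Phi> t > 0" using elim by simp
          have "\<Phi> t powr (1/(q*p)) * \<Phi> t powr (-1/(p*q)) = 1"
            using \<open>\<Phi> t > 0\<close> by (simp add: mult.commute flip: powr_add)
          then have "(a t * \<Phi> t powr (1/q)) powr (1/p) * (\<phi> t * \<Phi> t powr (-1/p)) powr (1/q)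
             = a t powr (1/p) * \<phi> t powr (1/q)"
            using nonneg elim by (simp add: powr_mult powr_powr)
          then show ?thesis using True by simp
        qed (auto simp: indicator_def)
      qed
    qed
    also have "\<dots> \<le> enn_powr (\<integral>\<^sup>+t. ennreal (?a t) \<partial>M) (1/p) * enn_powr (\<integral>\<^sup>+t. ennreal (?b t) \<partial>M) (1/q)"
      using nonneg pq by (intro Holder_nn_integral) auto
    also have "(\<integral>\<^sup>+t. ennreal (?a t) \<partial>M) = J x"
      unfolding J_def by (intro nn_integral_cong) (auto simp: indicator_def)
    also have "(\<integral>\<^sup>+t. ennreal (?b t) \<partial>M) = (\<integral>\<^sup>+t. ennreal (\<phi> t * \<Phi> t powr (-1/p)) * indicator {..x} t \<partial>M)"
      by (intro nn_integral_cong) (auto simp: indicator_def)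
    also have "enn_powr (J x) (1/p) * enn_powr \<dots> (1/q) \<le> enn_powr (J x) (1/p) * enn_powr (ennreal (q * \<Phi> x powr (1/q))) (1/q)"
      using pq by (intro mult_left_mono enn_powr_mono \<Phi>_int x) auto
    finally have "enn_powr (\<integral>\<^sup>+t. ennreal (a t powr (1/p) * \<phi> t powr (1/q)) * indicator {..x} t \<partial>M) p
       \<le> enn_powr (enn_powr (J x) (1/p) * enn_powr (ennreal (q * \<Phi> x powr (1/q))) (1/q)) p"
      using pq by (intro enn_powr_mono) auto
    also have "\<dots> = J x * ennreal ((q * \<Phi> x powr (1/q)) powr (p/q))"
      using pq by (simp add: enn_powr_mult enn_powr_powr enn_powr_ennreal powr_powr)
    also have "\<dots> \<le> J x * ennreal ((q * (B * V x powr (-1/p))) powr (p/q))"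
    proof -
      have "\<Phi> x powr (1/q) \<le> B * V x powr (-1/p)"
        using B(2)[OF x] V(2)[OF x] by (simp add: powr_minus field_simps)
      then show ?thesis using pq by (intro mult_left_mono ennreal_leI powr_mono2) auto
    qed
    also have "(q * (B * V x powr (-1/p))) powr (p/q) = q powr (p/q) * B powr (p/q) * V x powr (-1/q)"
      using pq B by (simp add: powr_mult powr_powr)
    finally show ?thesis
      using nonneg(3)[OF x] by (auto simp: ennreal_mult mult_ac dest: mult_right_mono[where c = "ennreal (w x)"])
  qed
  have Jm [measurable]: "J \<in> borel_measurable M"
    unfolding J_def by (intro borel_measurable_running_integral[OF sf id]) measurable
  have "(\<integral>\<^sup>+x. enn_powr (\<integral>\<^sup>+t. ennreal (a t powr (1/p) * \<phi> t powr (1/q)) * indicator {..x} t \<partial>M) p * ennreal (w x) \<partial>M)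
    \<le> (\<integral>\<^sup>+x. ennreal (q powr (p/q) * B powr (p/q)) * (J x * ennreal (w x * V x powr (-1/q))) \<partial>M)"
    by (intro nn_integral_mono ptw)
  also have "\<dots> = ennreal (q powr (p/q) * B powr (p/q)) * (\<integral>\<^sup>+x. J x * ennreal (w x * V x powr (-1/q)) \<partial>M)"
    by (rule nn_integral_cmult) measurable
  also have "(\<integral>\<^sup>+x. J x * ennreal (w x * V x powr (-1/q)) \<partial>M)
     = (\<integral>\<^sup>+t. ennreal (a t * \<Phi> t powr (1/q)) * (\<integral>\<^sup>+x. ennreal (w x * V x powr (-1/q)) * indicator {t..} x \<partial>M) \<partial>M)"
    unfolding J_def by (intro nn_integral_triangle_swap sf id) measurable
  also have "\<dots> \<le> (\<integral>\<^sup>+t. ennreal (p * B) * ennreal (a t) \<partial>M)"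
  proof (rule nn_integral_mono)
    fix t assume t: "t \<in> space M"
    have "ennreal (a t * \<Phi> t powr (1/q)) * (\<integral>\<^sup>+x. ennreal (w x * V x powr (-1/q)) * indicator {t..} x \<partial>M)
       \<le> ennreal (a t * \<Phi> t powr (1/q)) * ennreal (p * V t powr (1/p))"
      by (intro mult_left_mono V_int t) auto
    also have "\<dots> = ennreal (p * a t * (V t powr (1/p) * \<Phi> t powr (1/q)))"
      using nonneg(1)[OF t] pq by (simp add: mult_ac flip: ennreal_mult)
    also have "\<dots> \<le> ennreal (p * a t * B)"
      using nonneg(1)[OF t] pq by (intro ennreal_leI mult_left_mono B t) auto
    also have "\<dots> = ennreal (p * B) * ennreal (a t)"
      using nonneg(1)[OF t] pq B by (simp add: mult_ac flip: ennreal_mult)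
    finally show "ennreal (a t * \<Phi> t powr (1/q)) * (\<integral>\<^sup>+x. ennreal (w x * V x powr (-1/q)) * indicator {t..} x \<partial>M)
       \<le> ennreal (p * B) * ennreal (a t)" .
  qed
  also have "\<dots> = ennreal (p * B) * (\<integral>\<^sup>+t. ennreal (a t) \<partial>M)"
    by (rule nn_integral_cmult) measurable
  also have "ennreal (q powr (p/q) * B powr (p/q)) * (ennreal (p * B) * (\<integral>\<^sup>+t. ennreal (a t) \<partial>M))
     = ennreal (q powr (p/q) * p * B powr p) * (\<integral>\<^sup>+t. ennreal (a t) \<partial>M)"
  proof -
    have "B powr (p/q) * B = B powr p" using B(1) by (simp add: pq'(3) powr_diff)
    then have "ennreal (q powr (p/q) * p * B powr p) = ennreal (q powr (p/q) * B powr (p/q)) * ennreal (p * B)"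
      using pq B(1) by (subst ennreal_mult[symmetric]) (auto simp: mult_ac)
    then show ?thesis by (simp add: mult.assoc)
  qed
  finally show ?thesis by (simp add: mult_left_mono)
qed

section \<open>Factoring a function with finite running averages\<close>

text \<open>
  Let \<open>H\<close> be the running integral of \<open>h\<close>, and let \<open>A t\<close> be the integral of \<open>H\<^sup>p\<^sup>-\<^sup>1 w\<close> over the points
  not below \<open>t\<close>. The factors are \<open>a = h A\<close> and \<open>\<phi> = h A\<^sup>1\<^sup>-\<^sup>q\<close>. Exchanging integrals shows that \<open>h A\<close> has the
  integral \<open>\<integral> H\<^sup>p w\<close>. As \<open>A\<close> decreases and \<open>1 - q\<close> is negative, the integral of \<open>h A\<^sup>1\<^sup>-\<^sup>q\<close> up to
  \<open>t\<close> is at most \<open>A\<^sup>1\<^sup>-\<^sup>q H\<close> at \<open>t\<close>; as \<open>H\<close> increases, \<open>A \<ge> H\<^sup>p\<^sup>-\<^sup>1 V\<close>, and since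
  \<open>(p - 1) (1 - q) = -1\<close> the powers of \<open>H\<close> cancel, which leaves \<open>V\<^sup>1\<^sup>-\<^sup>q\<close>.
\<close>

lemma running_average_factorization:
  fixes M :: "real measure" and h w V :: "real \<Rightarrow> real" and p q :: real
  assumes sf: "sigma_finite_measure M" and id [measurable]: "(\<lambda>x. x) \<in> borel_measurable M"
    and [measurable]: "h \<in> borel_measurable M" "w \<in> borel_measurable M"
    and nonneg: "\<And>x. x \<in> space M \<Longrightarrow> 0 \<le> h x" "\<And>x. x \<in> space M \<Longrightarrow> 0 \<le> w x"
    and pq: "p > 1" "q > 1" "1/p + 1/q = 1"
    and V: "\<And>t. t \<in> space M \<Longrightarrow> (\<integral>\<^sup>+x. ennreal (w x) * indicator {t..} x \<partial>M) = ennreal (V t)"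
      "\<And>t. t \<in> space M \<Longrightarrow> 0 < V t"
    and E: "(\<integral>\<^sup>+x. enn_powr (\<integral>\<^sup>+t. ennreal (h t) * indicator {..x} t \<partial>M) p * ennreal (w x) \<partial>M) = E" "E < \<infinity>"
  obtains a \<phi> where "a \<in> borel_measurable M" "\<phi> \<in> borel_measurable M"
    "\<And>x. 0 \<le> a x" "\<And>x. 0 \<le> \<phi> x"
    "AE x in M. h x = a x powr (1/p) * \<phi> x powr (1/q)"
    "(\<integral>\<^sup>+x. ennreal (a x) \<partial>M) \<le> E"
    "\<And>t. t \<in> space M \<Longrightarrow> (\<integral>\<^sup>+s. ennreal (\<phi> s) * indicator {..t} s \<partial>M) \<le> ennreal (V t powr (1 - q))"
proof -
  note [measurable] = borel_measurable_indicator_ray[OF id]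
  have pq': "(p - 1) * (1 - q) = -1" using pq by (simp add: field_simps)
  define H where "H x = (\<integral>\<^sup>+t. ennreal (h t) * indicator {..x} t \<partial>M)" for x
  define k where "k x = enn_powr (H x) (p - 1) * ennreal (w x)" for x
  define A where "A t = (\<integral>\<^sup>+x. k x * indicator {t..} x \<partial>M)" for t
  have [measurable]: "H \<in> borel_measurable M"
    unfolding H_def by (intro borel_measurable_running_integral[OF sf id]) measurable
  have [measurable]: "k \<in> borel_measurable M" unfolding k_def by measurable
  have [measurable]: "A \<in> borel_measurable M"
    unfolding A_def by (intro borel_measurable_running_integral[OF sf id]) measurable
  have H_mono: "H s \<le> H t" if "s \<le> t" for s t
    unfolding H_def using that by (intro nn_integral_mono) (auto simp: indicator_def)
  have A_anti: "A t \<le> A s" if "s \<le> t" for s t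
    unfolding A_def using that by (intro nn_integral_mono) (auto simp: indicator_def)
  have E_eq: "E = (\<integral>\<^sup>+x. H x * k x \<partial>M)"
    unfolding E(1)[symmetric] H_def[symmetric] k_def
    using enn_powr_add[of 1 "p-1"] pq by (simp add: mult.assoc)
  also have "\<dots> = (\<integral>\<^sup>+t. ennreal (h t) * A t \<partial>M)"
    unfolding H_def A_def by (intro nn_integral_triangle_swap sf id) measurable
  finally have E_hA: "E = (\<integral>\<^sup>+t. ennreal (h t) * A t \<partial>M)" .
  have A_ge: "enn_powr (H t) (p - 1) * ennreal (V t) \<le> A t" if t: "t \<in> space M" for t
  proof -
    have "enn_powr (H t) (p - 1) * ennreal (V t)
        = (\<integral>\<^sup>+x. enn_powr (H t) (p - 1) * (ennreal (w x) * indicator {t..} x) \<partial>M)"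
      by (subst nn_integral_cmult) (auto simp: V(1)[OF t])
    also have "\<dots> \<le> A t"
      unfolding A_def k_def using pq
      by (intro nn_integral_mono)
         (auto simp: indicator_def intro!: mult_right_mono enn_powr_mono H_mono)
    finally show ?thesis .
  qed
  have HA_le: "H t * A t \<le> E" for t
  proof -
    have "H t * A t = (\<integral>\<^sup>+x. H t * (k x * indicator {t..} x) \<partial>M)"
      unfolding A_def by (rule nn_integral_cmult[symmetric]) measurable
    also have "\<dots> \<le> E" unfolding E_eq
      by (intro nn_integral_mono) (auto simp: indicator_def intro!: mult_right_mono H_mono)
    finally show ?thesis .
  qed
  \<comment> \<open>\<open>A\<close> may be infinite or zero, but only where \<open>H\<close> vanishes; almost everywhere \<open>h\<close> vanishes there too\<close>
  have H_pos_A: "0 < A t \<and> A t < \<infinity> \<and> H t < \<infinity>" if t: "t \<in> space M" "H t \<noteq> 0" for t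
  proof -
    have "0 < enn_powr (H t) (p - 1) * ennreal (V t)"
      using t V(2) by (auto simp: zero_less_iff_neq_zero[symmetric] ennreal_zero_less_mult_iff)
    with A_ge t have "0 < A t" by (auto intro: less_le_trans)
    moreover have "H t * A t \<noteq> top" using le_less_trans[OF HA_le[of t] E(2)] by (simp add: less_top)
    then have "A t \<noteq> top \<and> H t \<noteq> top" using t(2) \<open>0 < A t\<close>
      by (auto simp: ennreal_mult_eq_top_iff)
    ultimately show ?thesis by (simp add: less_top)
  qed
  define Ar where "Ar t = enn2real (A t)" for t
  define a where "a t = \<bar>h t\<bar> * Ar t" for t
  define \<phi> where "\<phi> t = (if H t = 0 then 0 else \<bar>h t\<bar> * Ar t powr (1 - q))" for t
  have [measurable]: "Ar \<in> borel_measurable M" unfolding Ar_def by measurable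
  have Ar: "A t = ennreal (Ar t)" "Ar t > 0" if t: "t \<in> space M" "H t \<noteq> 0" for t
    using H_pos_A[OF t] unfolding Ar_def by (auto simp: enn2real_positive_iff)
  have h_H: "AE t in M. h t \<noteq> 0 \<longrightarrow> H t \<noteq> 0"
  proof -
    have "AE t in M. ennreal (h t) \<noteq> 0 \<longrightarrow> (\<integral>\<^sup>+s. ennreal (h s) * indicator {s. s \<le> t} s \<partial>M) \<noteq> 0"
      by (rule AE_running_integral_pos) measurable
    then show ?thesis using AE_space
    proof eventually_elim
    case (elim t)
    then show ?case using nonneg(1)[of t] by (auto simp: H_def atMost_def ennreal_eq_0_iff)
    qed
  qed
  show ?thesis
  proof
    show "a \<in> borel_measurable M" "\<phi> \<in> borel_measurable M"
      unfolding a_def \<phi>_def by measurable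
    show "0 \<le> a x" "0 \<le> \<phi> x" for x
      by (auto simp: a_def \<phi>_def Ar_def)
    show "AE x in M. h x = a x powr (1/p) * \<phi> x powr (1/q)"
      using h_H AE_space
    proof eventually_elim
      case (elim x)
      show ?case
      proof (cases "h x = 0")
        case False
        then have H: "H x \<noteq> 0" and h: "h x > 0" using elim nonneg(1)[of x] by auto
        have "1/p + (1 - q)/q = 0" using pq by (simp add: diff_divide_distrib)
        moreover have "Ar x powr (1/p) * (Ar x powr (1 - q)) powr (1/q) = Ar x powr (1/p + (1 - q)/q)"
          unfolding powr_add by (simp add: powr_powr)
        ultimately have "Ar x powr (1/p) * (Ar x powr (1 - q)) powr (1/q) = 1"
          using Ar(2)[OF elim(2) H] by simp
        moreover have "h x powr (1/p) * h x powr (1/q) = h x"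
          using h pq by (simp flip: powr_add)
        ultimately have "(h x powr (1/p) * h x powr (1/q)) * (Ar x powr (1/p) * (Ar x powr (1 - q)) powr (1/q)) = h x"
          by simp
        then show ?thesis
          using H h Ar(2)[OF elim(2) H] pq by (simp add: a_def \<phi>_def powr_mult mult_ac)
      qed (simp add: a_def)
    qed
    show "(\<integral>\<^sup>+x. ennreal (a x) \<partial>M) \<le> E"
      unfolding E_hA
    proof (rule nn_integral_mono_AE)
      show "AE x in M. ennreal (a x) \<le> ennreal (h x) * A x"
        using h_H AE_space
      proof eventually_elim
        case (elim x)
        then show ?case using nonneg(1)[of x] Ar[of x]
          by (cases "h x = 0") (auto simp: a_def ennreal_mult)
      qed
    qed
  next
    fix t assume t: "t \<in> space M"
    show "(\<integral>\<^sup>+s. ennreal (\<phi> s) * indicator {..t} s \<partial>M) \<le> ennreal (V t powr (1 - q))"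
    proof (cases "H t = 0")
      case True
      have "H s = 0" if "s \<le> t" for s using H_mono[OF that] True by simp
      then have "(\<integral>\<^sup>+s. ennreal (\<phi> s) * indicator {..t} s \<partial>M) = (\<integral>\<^sup>+s. 0 \<partial>M)"
        by (intro nn_integral_cong) (auto simp: \<phi>_def indicator_def)
      then show ?thesis by simp
    next
      case False
      note At = Ar[OF t False]
      define Hr where "Hr = enn2real (H t)"
      have Hr: "H t = ennreal Hr" "Hr > 0"
        using H_pos_A[OF t False] False
        by (auto simp: Hr_def enn2real_positive_iff zero_less_iff_neq_zero)
      have "(\<integral>\<^sup>+s. ennreal (\<phi> s) * indicator {..t} s \<partial>M)
          \<le> (\<integral>\<^sup>+s. ennreal (Ar t powr (1 - q)) * (ennreal (h s) * indicator {..t} s) \<partial>M)"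
      proof (rule nn_integral_mono)
        fix s assume s: "s \<in> space M"
        show "ennreal (\<phi> s) * indicator {..t} s
           \<le> ennreal (Ar t powr (1 - q)) * (ennreal (h s) * indicator {..t} s)"
        proof (cases "s \<le> t \<and> H s \<noteq> 0")
          case True
          then have "Ar t \<le> Ar s" using A_anti[of s t] At Ar[OF s] by simp
          then have "Ar s powr (1 - q) \<le> Ar t powr (1 - q)"
            using At pq by (intro powr_mono2') auto
          then have "\<phi> s \<le> Ar t powr (1 - q) * h s"
            using True nonneg(1)[OF s] by (simp add: \<phi>_def mult.commute mult_left_mono)
          then show ?thesis using True nonneg(1)[OF s]
            by (simp flip: ennreal_mult add: ennreal_leI)
        qed (auto simp: \<phi>_def indicator_def)
      qed
      also have "\<dots> = ennreal (Ar t powr (1 - q)) * H t"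
        unfolding H_def by (rule nn_integral_cmult) measurable
      also have "\<dots> = ennreal (Ar t powr (1 - q) * Hr)"
        using Hr by (simp add: ennreal_mult)
      also have "Ar t powr (1 - q) * Hr \<le> V t powr (1 - q)"
      proof -
        have "Hr powr (p - 1) * V t \<le> Ar t"
          using A_ge[OF t] At Hr V(2)[OF t] by (simp add: enn_powr_ennreal flip: ennreal_mult)
        then have "Ar t powr (1 - q) \<le> (Hr powr (p - 1) * V t) powr (1 - q)"
          using Hr V(2)[OF t] pq by (intro powr_mono2') auto
        also have "\<dots> = Hr powr (-1) * V t powr (1 - q)"
          using Hr V(2)[OF t] by (simp add: powr_mult powr_powr pq')
        finally show ?thesis using Hr by (simp add: powr_minus field_simps)
      qed
      finally show ?thesis by (simp add: ennreal_leI)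
    qed
  qed
qed

section \<open>Integrals over the half-line\<close>

lemma sigma_finite_half_line: "sigma_finite_measure half_line"
proof (rule sigma_finite_measure_restrict_space)
  show "sigma_finite_measure (lebesgue :: real measure)"
  proof
    obtain A :: "real set set" where A: "countable A" "A \<subseteq> sets lborel" "\<Union>A = space lborel"
      "\<forall>a\<in>A. emeasure lborel a \<noteq> \<infinity>"
      using lborel.sigma_finite_countable by blast
    then have "\<forall>a\<in>A. a \<in> sets lebesgue \<and> emeasure lebesgue a \<noteq> \<infinity>"
      by (auto simp: sets_completionI_sets)
    with A show "\<exists>A::real set set. countable A \<and> A \<subseteq> sets lebesgue \<and> \<Union>A = space lebesgue \<and>
        (\<forall>a\<in>A. emeasure lebesgue a \<noteq> \<infinity>)"
      by (intro exI[of _ A]) auto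
  qed
qed simp

lemma measurable_ident_half_line: "(\<lambda>x. x) \<in> borel_measurable half_line"
  by (intro measurable_restrict_space1 measurable_completion) simp

lemma nn_integral_half_line:
  "(\<integral>\<^sup>+x\<in>{0<..}. f x \<partial>lebesgue) = (\<integral>\<^sup>+x. f x \<partial>half_line)"
  by (subst nn_integral_restrict_space) auto

lemma AE_lebesgue_neq: "AE x in lebesgue. x \<noteq> (t::real)"
  by (rule AE_completion) (rule AE_lborel_singleton)

text \<open>
  The running integrals above use closed rays, the norms of the theorem open intervals; single points
  are null sets.
\<close>

lemma nn_integral_half_line_atMost:
  "(\<integral>\<^sup>+x\<in>{0<..<t}. f x \<partial>lebesgue) = (\<integral>\<^sup>+x. f x * indicator {..t} x \<partial>half_line)"
  unfolding nn_integral_half_line[symmetric] using AE_lebesgue_neq[of t]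
  by (intro nn_integral_cong_AE, eventually_elim) (auto simp: indicator_def)

lemma nn_integral_half_line_atLeast:
  assumes "t > 0"
  shows "(\<integral>\<^sup>+x\<in>{t<..}. f x \<partial>lebesgue) = (\<integral>\<^sup>+x. f x * indicator {t..} x \<partial>half_line)"
  unfolding nn_integral_half_line[symmetric] using AE_lebesgue_neq[of t]
  by (intro nn_integral_cong_AE, eventually_elim) (use assms in \<open>auto simp: indicator_def\<close>)

lemma nn_integral_pos_half_line:
  assumes [measurable]: "f \<in> borel_measurable half_line" "(indicator S :: real \<Rightarrow> ennreal) \<in> borel_measurable half_line"
    and pos: "AE x in half_line. 0 < f x"
    and S: "{c<..<d} \<subseteq> S" "0 \<le> c" "c < d"
  shows "(\<integral>\<^sup>+x. ennreal (f x) * indicator S x \<partial>half_line) > 0"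
proof (rule ccontr)
  assume "\<not> ?thesis"
  then have "(\<integral>\<^sup>+x. ennreal (f x) * indicator S x \<partial>half_line) = 0" by simp
  then have "AE x in half_line. ennreal (f x) * indicator S x = 0"
    by (subst (asm) nn_integral_0_iff_AE) auto
  with pos have "AE x in half_line. x \<notin> S"
    by eventually_elim (auto simp: indicator_def ennreal_eq_0_iff split: if_splits)
  then have "AE x in lebesgue. x \<notin> {c<..<d}"
    using S by (subst (asm) AE_restrict_space_iff) (auto elim!: eventually_mono)
  then have "emeasure lebesgue {x\<in>space lebesgue. x \<in> {c<..<d}} = 0"
    by (rule emeasure_eq_0_AE)
  also have "{x\<in>space lebesgue. x \<in> {c<..<d}} = {c<..<d}" by auto
  finally show False using S by simp
qed

lemma conj_exp_properties:
  assumes "p > 1"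
  shows "conj_exp p > 1" "1 / p + 1 / conj_exp p = 1"
  using assms by (auto simp: conj_exp_def field_simps)

text \<open>
  Absorbing the factor \<open>x\<^sup>-\<^sup>p\<close> into the weight turns averages into running integrals. The weight is
  truncated at \<open>0\<close> to be nonnegative at every point, not just almost everywhere, without changing its
  value as an extended nonnegative real.
\<close>

lemma Ces_norm_half_line:
  assumes p: "p > 0"
  shows "Ces_norm p v h = enn_powr (\<integral>\<^sup>+x. enn_powr (\<integral>\<^sup>+t. ennreal \<bar>h t\<bar> * indicator {..x} t \<partial>half_line) p
      * ennreal (max 0 (v x) / x powr p) \<partial>half_line) (1 / p)"
proof -
  have "enn_powr (ennreal (1 / x) * I) p * ennreal (v x) = enn_powr I p * ennreal (max 0 (v x) / x powr p)"
    if "x > 0" for x I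
  proof -
    have "ennreal (max 0 (v x) / x powr p) = ennreal ((1 / x) powr p * v x)"
      using that by (auto simp: powr_divide max_def ennreal_neg mult_nonneg_nonpos field_simps intro!: ennreal_neg)
    also have "\<dots> = ennreal ((1 / x) powr p) * ennreal (v x)"
      by (rule ennreal_mult') simp
    finally show ?thesis
      using that p by (simp add: enn_powr_mult enn_powr_ennreal mult_ac)
  qed
  then show ?thesis
    unfolding Ces_norm_def nn_integral_half_line nn_integral_half_line_atMost
    by (intro arg_cong[where f = "\<lambda>x. enn_powr x _"] nn_integral_cong) auto
qed

section \<open>The two bounds for weighted Cesaro norms\<close>

text \<open>
  Both integrals in the condition of Muckenhoupt type are positive because the weight is positive
  almost everywhere, and a bound on their product then forces both to be finite. In particular
  \<open>v powr (1 - conj_exp p)\<close> is integrable near \<open>0\<close>.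
\<close>

lemma class_M_integrals:
  assumes p: "p > 1" and v: "v \<in> class_M p"
  obtains U V :: "real \<Rightarrow> real"
  where "\<And>t. t > 0 \<Longrightarrow> 0 < U t" "\<And>t. t > 0 \<Longrightarrow> 0 < V t"
    "\<And>t. t > 0 \<Longrightarrow> (\<integral>\<^sup>+x. ennreal (v x powr (1 - conj_exp p)) * indicator {..t} x \<partial>half_line) = ennreal (U t)"
    "\<And>t. t > 0 \<Longrightarrow> (\<integral>\<^sup>+x. ennreal (max 0 (v x) / x powr p) * indicator {t..} x \<partial>half_line) = ennreal (V t)"
    "\<And>t. t > 0 \<Longrightarrow> M_expr p v t = ennreal (V t powr (1/p) * U t powr (1/conj_exp p))"
proof -
  define q where "q = conj_exp p"
  have q: "q > 1" using conj_exp_properties[OF p] by (simp add: q_def)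
  note [measurable] = measurable_ident_half_line borel_measurable_indicator_ray[OF measurable_ident_half_line]
  have [measurable]: "v \<in> borel_measurable half_line" and pos: "AE x in half_line. v x > 0"
    using v by (auto simp: class_M_def weight_def)
  define EU where "EU t = (\<integral>\<^sup>+x. ennreal (v x powr (1 - q)) * indicator {..t} x \<partial>half_line)" for t
  define EV where "EV t = (\<integral>\<^sup>+x. ennreal (max 0 (v x) / x powr p) * indicator {t..} x \<partial>half_line)" for t
  have posU: "EU t > 0" if "t > 0" for t
    unfolding EU_def
  proof (rule nn_integral_pos_half_line)
    show "AE x in half_line. 0 < v x powr (1 - q)" using pos by eventually_elim auto
  qed (use that in auto)
  have posV: "EV t > 0" if "t > 0" for t
    unfolding EV_def
  proof (rule nn_integral_pos_half_line)
    show "AE x in half_line. 0 < max 0 (v x) / x powr p"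
      using pos AE_space by eventually_elim auto
    show "{t<..<t+1} \<subseteq> {t..}" by auto
  qed (use that in \<open>auto intro: borel_measurable_divide\<close>)
  have EV_eq: "(\<integral>\<^sup>+x\<in>{t<..}. ennreal (v x / x powr p) \<partial>lebesgue) = EV t" if "t > 0" for t
    unfolding EV_def nn_integral_half_line_atLeast[OF that]
    by (intro nn_integral_cong) (auto simp: max_def ennreal_neg divide_nonpos_nonneg)
  have M: "M_expr p v t = enn_powr (EV t) (1/p) * enn_powr (EU t) (1/q)" if "t > 0" for t
    unfolding M_expr_def EV_eq[OF that] by (simp add: nn_integral_half_line_atMost EU_def q_def)
  obtain C where C: "\<And>t. t > 0 \<Longrightarrow> M_expr p v t \<le> ennreal C"
    using v by (auto simp: class_M_def)
  have fin: "EV t \<noteq> top \<and> EU t \<noteq> top" if t: "t > 0" for t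
  proof -
    have "M_expr p v t \<noteq> top" using C[OF t] by (auto simp: top_unique)
    moreover have "enn_powr (EV t) (1/p) \<noteq> 0" "enn_powr (EU t) (1/q) \<noteq> 0"
      using posU[OF t] posV[OF t] by (simp_all flip: zero_less_iff_neq_zero)
    ultimately show ?thesis unfolding M[OF t] by (auto simp: ennreal_mult_eq_top_iff)
  qed
  show ?thesis
  proof
    fix t :: real assume t: "t > 0"
    show "enn2real (EU t) > 0" "enn2real (EV t) > 0"
      using posU[OF t] posV[OF t] fin[OF t] by (auto simp: enn2real_positive_iff less_top)
    show EU: "(\<integral>\<^sup>+x. ennreal (v x powr (1 - conj_exp p)) * indicator {..t} x \<partial>half_line) = ennreal (enn2real (EU t))"
      using fin[OF t] by (simp add: EU_def q_def less_top)
    show "(\<integral>\<^sup>+x. ennreal (max 0 (v x) / x powr p) * indicator {t..} x \<partial>half_line) = ennreal (enn2real (EV t))"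
      using fin[OF t] by (simp add: EV_def less_top)
    show "M_expr p v t = ennreal (enn2real (EV t) powr (1/p) * enn2real (EU t) powr (1/conj_exp p))"
      using fin[OF t] by (simp add: M[OF t] enn_powr_def ennreal_mult q_def)
  qed
qed

text \<open>
  This is Hardy's inequality for \<open>a = \<bar>f\<bar>\<^sup>p v\<close> and \<open>\<phi> = \<bar>g\<bar>\<^sup>q u\<close>, where \<open>u = v\<^sup>1\<^sup>-\<^sup>q\<close>: the weights cancel in
  \<open>a\<^sup>1\<^sup>/\<^sup>p \<phi>\<^sup>1\<^sup>/\<^sup>q = \<bar>f g\<bar>\<close>, and the norm \<open>G\<close> of \<open>g\<close> bounds the running integral of \<open>\<phi>\<close> by
  \<open>G\<^sup>q\<close> times that of \<open>u\<close>, so that the hypothesis of Hardy's inequality holds with \<open>B = G C\<close>.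
\<close>

lemma Ces_norm_product_le:
  assumes p: "p > 1" and v: "v \<in> class_M p"
    and C: "C > 0" "\<And>t. t > 0 \<Longrightarrow> M_expr p v t \<le> ennreal C"
    and f: "f \<in> Lp_space p v" and g: "g \<in> G_space (conj_exp p) (\<lambda>x. v x powr (1 - conj_exp p))"
    and h: "AE x in half_line. h x = f x * g x"
  shows "Ces_norm p v h \<le> ennreal (conj_exp p powr (1 / conj_exp p) * p powr (1/p)) * ennreal C
     * (Lp_norm p v f * G_norm (conj_exp p) (\<lambda>x. v x powr (1 - conj_exp p)) g)"
proof -
  define q where "q = conj_exp p"
  have pq: "p > 1" "q > 1" "1/p + 1/q = 1" using conj_exp_properties[OF p] p by (simp_all add: q_def)
  note [measurable] = measurable_ident_half_line borel_measurable_indicator_ray[OF measurable_ident_half_line]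
  have vm [measurable]: "v \<in> borel_measurable half_line" and pos: "AE x in half_line. v x > 0"
    using v by (auto simp: class_M_def weight_def)
  have fm [measurable]: "f \<in> borel_measurable half_line" "g \<in> borel_measurable half_line"
    using f g by (auto simp: Lp_space_def G_space_def)
  obtain U V where U1: "\<And>t. t > 0 \<Longrightarrow> 0 < U t" and V1: "\<And>t. t > 0 \<Longrightarrow> 0 < V t"
    and U2: "\<And>t. t > 0 \<Longrightarrow> (\<integral>\<^sup>+x. ennreal (v x powr (1 - q)) * indicator {..t} x \<partial>half_line) = ennreal (U t)"
    and V2: "\<And>t. t > 0 \<Longrightarrow> (\<integral>\<^sup>+x. ennreal (max 0 (v x) / x powr p) * indicator {t..} x \<partial>half_line) = ennreal (V t)"
    and M: "\<And>t. t > 0 \<Longrightarrow> M_expr p v t = ennreal (V t powr (1/p) * U t powr (1/q))"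
    using class_M_integrals[OF p v, folded q_def] by blast
  note U = U1 U2 and V = V1 V2
  define N where "N = G_norm q (\<lambda>x. v x powr (1 - q)) g"
  define G where "G = enn2real N"
  have G: "N = ennreal G" "G \<ge> 0"
    using g by (auto simp: G_def N_def q_def G_space_def)
  define a where "a x = \<bar>f x\<bar> powr p * max 0 (v x)" for x
  define \<phi> where "\<phi> x = \<bar>g x\<bar> powr q * v x powr (1 - q)" for x
  have [measurable]: "a \<in> borel_measurable half_line" "\<phi> \<in> borel_measurable half_line"
    unfolding a_def \<phi>_def by measurable
  define E\<Phi> where "E\<Phi> t = (\<integral>\<^sup>+s. ennreal (\<phi> s) * indicator {..t} s \<partial>half_line)" for t
  have \<Phi>_le: "E\<Phi> t \<le> ennreal (G powr q * U t)" if t: "t > 0" for t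
  proof -
    have "enn_powr (1 / ennreal (U t) * E\<Phi> t) (1/q) \<le> N"
      unfolding N_def G_norm_def E\<Phi>_def \<phi>_def using t
      by (intro SUP_upper2[of t]) (simp_all add: nn_integral_half_line_atMost U(2))
    then have "enn_powr (enn_powr (1 / ennreal (U t) * E\<Phi> t) (1/q)) q \<le> enn_powr (ennreal G) q"
      using pq G by (intro enn_powr_mono) auto
    then have "1 / ennreal (U t) * E\<Phi> t \<le> ennreal (G powr q)"
      using pq G by (simp add: enn_powr_powr enn_powr_ennreal)
    then have "ennreal (U t) * (1 / ennreal (U t) * E\<Phi> t) \<le> ennreal (U t) * ennreal (G powr q)"
      by (rule mult_left_mono) simp
    moreover have "ennreal (U t) * (1 / ennreal (U t) * E\<Phi> t) = E\<Phi> t"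
    proof -
      have "ennreal (U t) * (1 / ennreal (U t)) = 1"
        using U(1)[OF t] by (simp add: divide_ennreal flip: ennreal_1 ennreal_mult)
      then show ?thesis by (simp flip: mult.assoc)
    qed
    ultimately show ?thesis using U(1)[OF t] by (simp add: ennreal_mult mult.commute)
  qed
  define \<Phi> where "\<Phi> t = enn2real (E\<Phi> t)" for t
  have \<Phi>: "E\<Phi> t = ennreal (\<Phi> t)" "\<Phi> t \<ge> 0" "\<Phi> t \<le> G powr q * U t" if t: "t > 0" for t
  proof -
    show eq: "E\<Phi> t = ennreal (\<Phi> t)"
      using le_less_trans[OF \<Phi>_le[OF t]] by (auto simp: \<Phi>_def)
    show "\<Phi> t \<ge> 0" by (simp add: \<Phi>_def)
    then show "\<Phi> t \<le> G powr q * U t" using \<Phi>_le[OF t] U(1)[OF t] unfolding eq by (simp add: ennreal_le_iff)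
  qed
  have VU: "V t powr (1/p) * U t powr (1/q) \<le> C" if "t > 0" for t
    using C(2)[OF that] C(1) unfolding M[OF that] by (simp add: ennreal_le_iff)
  have B: "V t powr (1/p) * \<Phi> t powr (1/q) \<le> G * C" if t: "t > 0" for t
  proof -
    have "\<Phi> t powr (1/q) \<le> (G powr q * U t) powr (1/q)"
      using \<Phi>[OF t] pq by (intro powr_mono2) auto
    also have "\<dots> = G * U t powr (1/q)"
      using G U(1)[OF t] pq by (simp add: powr_mult powr_powr)
    finally have "V t powr (1/p) * \<Phi> t powr (1/q) \<le> V t powr (1/p) * (G * U t powr (1/q))"
      by (intro mult_left_mono) auto
    also have "\<dots> \<le> G * C" using mult_left_mono[OF VU[OF t] G(2)] by (simp add: mult_ac)
    finally show ?thesis .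
  qed
  have h_eq: "AE x in half_line. \<bar>h x\<bar> = a x powr (1/p) * \<phi> x powr (1/q)"
    using h pos
  proof eventually_elim
    case (elim x)
    have "(1 - q) / q = - (1/p)" using pq by (simp add: diff_divide_distrib)
    then have "v x powr (1/p) * (v x powr (1 - q)) powr (1/q) = 1"
      using elim(2) by (simp add: powr_powr powr_minus)
    then show ?case using elim pq
      by (simp add: a_def \<phi>_def powr_mult powr_powr abs_mult mult_ac)
  qed
  have "(\<integral>\<^sup>+x. enn_powr (\<integral>\<^sup>+t. ennreal \<bar>h t\<bar> * indicator {..x} t \<partial>half_line) p
      * ennreal (max 0 (v x) / x powr p) \<partial>half_line)
    = (\<integral>\<^sup>+x. enn_powr (\<integral>\<^sup>+t. ennreal (a t powr (1/p) * \<phi> t powr (1/q)) * indicator {..x} t \<partial>half_line) p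
      * ennreal (max 0 (v x) / x powr p) \<partial>half_line)"
  proof -
    have "(\<integral>\<^sup>+t. ennreal \<bar>h t\<bar> * indicator {..x} t \<partial>half_line)
      = (\<integral>\<^sup>+t. ennreal (a t powr (1/p) * \<phi> t powr (1/q)) * indicator {..x} t \<partial>half_line)" for x
      using h_eq by (intro nn_integral_cong_AE, eventually_elim) simp
    then show ?thesis by simp
  qed
  also have "\<dots> \<le> ennreal (q powr (p/q) * p * (G * C) powr p) * (\<integral>\<^sup>+t. ennreal (a t) \<partial>half_line)"
  proof (rule Hardy_Muckenhoupt[where \<Phi> = \<Phi> and V = V])
    fix t assume "t \<in> space half_line"
    then have t: "t > 0" by simp
    show "(\<integral>\<^sup>+s. ennreal (\<phi> s) * indicator {..t} s \<partial>half_line) = ennreal (\<Phi> t)"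
      using \<Phi>(1)[OF t] by (simp add: E\<Phi>_def)
    show "0 \<le> \<Phi> t" "0 < V t" "V t powr (1/p) * \<Phi> t powr (1/q) \<le> G * C"
      "(\<integral>\<^sup>+x. ennreal (max 0 (v x) / x powr p) * indicator {t..} x \<partial>half_line) = ennreal (V t)"
      using \<Phi>[OF t] V[OF t] B[OF t] by auto
  qed (use pq G C sigma_finite_half_line in \<open>auto simp: a_def \<phi>_def intro: borel_measurable_divide\<close>)
  also have "(\<integral>\<^sup>+t. ennreal (a t) \<partial>half_line) = (\<integral>\<^sup>+t. ennreal (\<bar>f t\<bar> powr p * v t) \<partial>half_line)"
    using pos by (intro nn_integral_cong_AE, eventually_elim) (simp add: a_def)
  finally have "Ces_norm p v h \<le> enn_powr (ennreal (q powr (p/q) * p * (G * C) powr p)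
     * (\<integral>\<^sup>+t. ennreal (\<bar>f t\<bar> powr p * v t) \<partial>half_line)) (1/p)"
    using pq by (subst Ces_norm_half_line) (auto intro!: enn_powr_mono)
  also have "\<dots> = ennreal ((q powr (p/q) * p * (G * C) powr p) powr (1/p)) * Lp_norm p v f"
    using pq by (simp add: enn_powr_mult enn_powr_ennreal Lp_norm_def nn_integral_half_line)
  also have "(q powr (p/q) * p * (G * C) powr p) powr (1/p) = (q powr (1/q) * p powr (1/p)) * C * G"
    using pq G C by (simp add: powr_mult powr_powr)
  also have "ennreal \<dots> * Lp_norm p v f = ennreal (q powr (1/q) * p powr (1/p)) * ennreal C * (Lp_norm p v f * N)"
    using G C pq by (simp add: ennreal_mult mult_ac)
  finally show ?thesis by (simp add: q_def N_def)
qed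

text \<open>
  The factors \<open>a\<close> and \<open>\<phi>\<close> of \<open>\<bar>h\<bar>\<close> determine \<open>f\<close> and \<open>g\<close> by \<open>a = f\<^sup>p v\<close> and \<open>\<phi> = \<bar>g\<bar>\<^sup>q u\<close> with
  \<open>u = v\<^sup>1\<^sup>-\<^sup>q\<close>; the sign of \<open>h\<close> goes to \<open>g\<close>. The running integral of \<open>\<phi>\<close> is at most \<open>V\<^sup>1\<^sup>-\<^sup>q\<close>, and
  the lower bound \<open>C \<le> V\<^sup>1\<^sup>/\<^sup>p U\<^sup>1\<^sup>/\<^sup>q\<close> says exactly that this is at most \<open>C\<^sup>-\<^sup>q U\<close>. One and the same
  \<open>g\<close> serves all admissible constants \<open>C\<close>.
\<close>

lemma Ces_factorization_half_line:
  assumes p: "p > 1" and v: "v \<in> class_M p" "v \<in> class_m p" and h: "h \<in> Ces p v"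
  obtains f g where "f \<in> Lp_space p v" "g \<in> G_space (conj_exp p) (\<lambda>x. v x powr (1 - conj_exp p))"
    "AE x in half_line. h x = f x * g x"
    "Lp_norm p v f \<le> Ces_norm p v h"
    "\<forall>C>0. (\<forall>t>0. M_expr p v t \<ge> ennreal C) \<longrightarrow>
        G_norm (conj_exp p) (\<lambda>x. v x powr (1 - conj_exp p)) g \<le> ennreal (1 / C)"
proof -
  define q where "q = conj_exp p"
  have pq: "p > 1" "q > 1" "1/p + 1/q = 1" using conj_exp_properties[OF p] p by (simp_all add: q_def)
  have q1: "(1 - q) / q = - (1/p)" using pq by (simp add: diff_divide_distrib)
  note [measurable] = measurable_ident_half_line borel_measurable_indicator_ray[OF measurable_ident_half_line]
  have vm [measurable]: "v \<in> borel_measurable half_line" and pos: "AE x in half_line. v x > 0"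
    using v by (auto simp: class_M_def weight_def)
  have hm [measurable]: "h \<in> borel_measurable half_line"
    using h by (auto simp: Ces_def)
  obtain U V where U1: "\<And>t. t > 0 \<Longrightarrow> 0 < U t" and V1: "\<And>t. t > 0 \<Longrightarrow> 0 < V t"
    and U2: "\<And>t. t > 0 \<Longrightarrow> (\<integral>\<^sup>+x. ennreal (v x powr (1 - q)) * indicator {..t} x \<partial>half_line) = ennreal (U t)"
    and V2: "\<And>t. t > 0 \<Longrightarrow> (\<integral>\<^sup>+x. ennreal (max 0 (v x) / x powr p) * indicator {t..} x \<partial>half_line) = ennreal (V t)"
    and M: "\<And>t. t > 0 \<Longrightarrow> M_expr p v t = ennreal (V t powr (1/p) * U t powr (1/q))"
    using class_M_integrals[OF p v(1), folded q_def] by blast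
  note U = U1 U2 and V = V1 V2
  define E where "E = (\<integral>\<^sup>+x. enn_powr (\<integral>\<^sup>+t. ennreal \<bar>h t\<bar> * indicator {..x} t \<partial>half_line) p
      * ennreal (max 0 (v x) / x powr p) \<partial>half_line)"
  have CesE: "Ces_norm p v h = enn_powr E (1/p)"
    using pq by (simp add: Ces_norm_half_line E_def)
  have "Ces_norm p v h < top" using h by (simp add: Ces_def)
  then have "E < \<infinity>" unfolding CesE by simp
  obtain a \<phi> where [measurable]: "a \<in> borel_measurable half_line" "\<phi> \<in> borel_measurable half_line"
    and nonneg: "\<And>x. 0 \<le> a x" "\<And>x. 0 \<le> \<phi> x"
    and h_eq: "AE x in half_line. \<bar>h x\<bar> = a x powr (1/p) * \<phi> x powr (1/q)"
    and a_le: "(\<integral>\<^sup>+x. ennreal (a x) \<partial>half_line) \<le> E"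
    and \<phi>_le: "\<And>t. t \<in> space half_line \<Longrightarrow>
        (\<integral>\<^sup>+s. ennreal (\<phi> s) * indicator {..t} s \<partial>half_line) \<le> ennreal (V t powr (1 - q))"
  proof (rule running_average_factorization[OF sigma_finite_half_line measurable_ident_half_line,
      of "\<lambda>x. \<bar>h x\<bar>" "\<lambda>x. max 0 (v x) / x powr p" p q V E])
  qed (use pq V \<open>E < \<infinity>\<close> in \<open>auto simp: E_def intro: borel_measurable_divide\<close>)
  define f where "f x = (a x / v x) powr (1/p)" for x
  define g where "g x = sgn (h x) * (\<phi> x / v x powr (1 - q)) powr (1/q)" for x
  have [measurable]: "f \<in> borel_measurable half_line" "g \<in> borel_measurable half_line"
    unfolding f_def g_def by measurable
  have fg: "AE x in half_line. h x = f x * g x"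
    using h_eq pos
  proof eventually_elim
    case (elim x)
    have "v x powr (1/p) * (v x powr (1 - q)) powr (1/q) = 1"
      using elim(2) q1 by (simp add: powr_powr powr_minus)
    then have "f x * g x = sgn (h x) * (a x powr (1/p) * \<phi> x powr (1/q))"
      using elim(2) nonneg by (simp add: f_def g_def powr_divide mult_ac)
    then show ?case unfolding elim(1)[symmetric] by (simp add: sgn_mult_abs)
  qed
  have f_norm: "Lp_norm p v f \<le> Ces_norm p v h"
  proof -
    have "(\<integral>\<^sup>+x. ennreal (\<bar>f x\<bar> powr p * v x) \<partial>half_line) = (\<integral>\<^sup>+x. ennreal (a x) \<partial>half_line)"
      using pos by (intro nn_integral_cong_AE, eventually_elim)
        (use pq nonneg in \<open>simp add: f_def powr_powr\<close>)
    then show ?thesis unfolding CesE Lp_norm_def nn_integral_half_line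
      using a_le pq by (intro enn_powr_mono) auto
  qed
  have g_norm: "G_norm q (\<lambda>x. v x powr (1 - q)) g \<le> ennreal (1 / C)"
    if C: "C > 0" "\<And>t. t > 0 \<Longrightarrow> M_expr p v t \<ge> ennreal C" for C
    unfolding G_norm_def
  proof (rule SUP_least)
    fix t :: real assume "t \<in> {0<..}"
    then have t: "t > 0" by simp
    have "(\<integral>\<^sup>+s. ennreal (\<bar>g s\<bar> powr q * v s powr (1 - q)) * indicator {..t} s \<partial>half_line)
       \<le> (\<integral>\<^sup>+s. ennreal (\<phi> s) * indicator {..t} s \<partial>half_line)"
    proof (rule nn_integral_mono_AE)
      show "AE x in half_line. ennreal (\<bar>g x\<bar> powr q * v x powr (1 - q)) * indicator {..t} x
         \<le> ennreal (\<phi> x) * indicator {..t} x"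
        using pos
      proof eventually_elim
        case (elim x)
        have "\<bar>g x\<bar> powr q * v x powr (1 - q) \<le> \<phi> x"
          using elim nonneg(2)[of x] pq
          by (cases "h x = 0") (auto simp: g_def abs_mult powr_powr)
        then show ?case by (intro mult_right_mono ennreal_leI) auto
      qed
    qed
    also have "\<dots> \<le> ennreal (V t powr (1 - q))" using t by (intro \<phi>_le) auto
    finally have le: "(\<integral>\<^sup>+s. ennreal (\<bar>g s\<bar> powr q * v s powr (1 - q)) * indicator {..t} s \<partial>half_line)
       \<le> ennreal (V t powr (1 - q))" .
    have "1 / ennreal (U t) * (\<integral>\<^sup>+s. ennreal (\<bar>g s\<bar> powr q * v s powr (1 - q)) * indicator {..t} s \<partial>half_line)
       \<le> ennreal (1 / U t) * ennreal (V t powr (1 - q))"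
      using U(1)[OF t] divide_ennreal[of 1 "U t"] le by (intro mult_mono) auto
    also have "\<dots> = ennreal (1 / U t * V t powr (1 - q))"
      using U(1)[OF t] by (subst ennreal_mult) auto
    finally have "enn_powr (1 / ennreal (U t) * (\<integral>\<^sup>+s. ennreal (\<bar>g s\<bar> powr q * v s powr (1 - q)) * indicator {..t} s \<partial>half_line)) (1/q)
       \<le> enn_powr (ennreal (1 / U t * V t powr (1 - q))) (1/q)"
      using pq by (intro enn_powr_mono) auto
    also have "\<dots> = ennreal ((1 / U t * V t powr (1 - q)) powr (1/q))"
      using U(1)[OF t] by (intro enn_powr_ennreal) auto
    also have "(1 / U t * V t powr (1 - q)) powr (1/q) = 1 / (V t powr (1/p) * U t powr (1/q))"
    proof -
      have "(V t powr (1 - q)) powr (1/q) = 1 / V t powr (1/p)"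
        using q1 by (simp add: powr_powr powr_minus_divide)
      then show ?thesis using U(1)[OF t] by (simp add: powr_mult powr_divide)
    qed
    also have "ennreal \<dots> \<le> ennreal (1 / C)"
      using C(2)[OF t] C(1) U(1)[OF t] V(1)[OF t] unfolding M[OF t]
      by (intro ennreal_leI divide_left_mono) (auto simp: ennreal_le_iff)
    finally show "enn_powr (1 / (\<integral>\<^sup>+x\<in>{0<..<t}. ennreal (v x powr (1 - q)) \<partial>lebesgue)
       * (\<integral>\<^sup>+x\<in>{0<..<t}. ennreal (\<bar>g x\<bar> powr q * v x powr (1 - q)) \<partial>lebesgue)) (1/q) \<le> ennreal (1 / C)"
      by (simp add: nn_integral_half_line_atMost U(2)[OF t])
  qed
  show ?thesis
  proof (rule that[OF _ _ fg f_norm])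
    show "f \<in> Lp_space p v"
      using f_norm h by (auto simp: Lp_space_def Ces_def intro: le_less_trans)
    obtain C where "C > 0" "\<And>t. t > 0 \<Longrightarrow> M_expr p v t \<ge> ennreal C"
      using v(2) by (auto simp: class_m_def)
    from g_norm[OF this] show "g \<in> G_space (conj_exp p) (\<lambda>x. v x powr (1 - conj_exp p))"
      by (auto simp: G_space_def q_def intro: le_less_trans)
  qed (use g_norm in \<open>simp add: q_def\<close>)
qed

text \<open>
  An infimum need not be an admissible constant by definition, but here each bound passes to the limit.
  That it is positive and finite allows division by it when it is compared with an infimum over
  factorizations.
\<close>

lemma const_M_attained:
  assumes p: "p > 1" and v: "v \<in> class_M p"
  obtains C where "C > 0" "const_M p v = ennreal C" "\<And>t. t > 0 \<Longrightarrow> M_expr p v t \<le> ennreal C"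
proof -
  obtain U V :: "real \<Rightarrow> real" where UV: "\<And>t. t > 0 \<Longrightarrow> 0 < U t" "\<And>t. t > 0 \<Longrightarrow> 0 < V t"
    "\<And>t. t > 0 \<Longrightarrow> M_expr p v t = ennreal (V t powr (1/p) * U t powr (1/conj_exp p))"
    by (rule class_M_integrals[OF p v]) (rule that; assumption)
  have le: "M_expr p v t \<le> const_M p v" if "t > 0" for t
    unfolding const_M_def by (rule INF_greatest) (simp add: that)
  have "0 < M_expr p v 1" using UV[of 1] by simp
  then have pos: "0 < const_M p v" using le[of 1] by (rule less_le_trans) simp
  obtain C where "C > 0" "\<forall>t>0. M_expr p v t \<le> ennreal C"
    using v unfolding class_M_def by blast
  then have "const_M p v \<le> ennreal C" unfolding const_M_def by (intro INF_lower) blast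
  then have fin: "const_M p v < top" by (rule le_less_trans) simp
  show ?thesis
  proof (rule that)
    show "0 < enn2real (const_M p v)" using pos fin by (simp add: enn2real_positive_iff)
    show eq: "const_M p v = ennreal (enn2real (const_M p v))" using fin by simp
    show "M_expr p v t \<le> ennreal (enn2real (const_M p v))" if "t > 0" for t
      using le[OF that] unfolding eq[symmetric] .
  qed
qed

section \<open>The factorization of weighted Cesaro spaces\<close>

theorem theorem3p1:
  fixes p p' :: real and v :: "real \<Rightarrow> real"
  assumes "p > 1" and "p' = conj_exp p"
    and "v \<in> class_M p" and "v \<in> class_m p"
  shows "\<forall>h \<in> borel_measurable half_line.
    (h \<in> Ces p v \<longleftrightarrow>
       (\<exists>f \<in> Lp_space p v. \<exists>g \<in> G_space p' (\<lambda>x. v x powr (1 - p')).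
          AE x in half_line. h x = f x * g x)) \<and>
    (h \<in> Ces p v \<longrightarrow>
       const_m p v * factor_norm p v h \<le> Ces_norm p v h \<and>
       Ces_norm p v h
         \<le> ennreal (p' powr (1 / p') * p powr (1 / p)) * const_M p v * factor_norm p v h)"
proof (intro ballI conjI impI)
  fix h :: "real \<Rightarrow> real" assume hm: "h \<in> borel_measurable half_line"
  let ?G = "\<lambda>g. G_norm p' (\<lambda>x. v x powr (1 - p')) g"
  obtain C where C: "C > 0" "const_M p v = ennreal C" "\<And>t. t > 0 \<Longrightarrow> M_expr p v t \<le> ennreal C"
    by (rule const_M_attained[OF assms(1,3)]) (rule that; assumption)
  let ?K = "ennreal (p' powr (1 / p') * p powr (1 / p)) * const_M p v"
  have upper: "Ces_norm p v h \<le> ?K * (Lp_norm p v f * ?G g)"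
    if "f \<in> Lp_space p v" "g \<in> G_space p' (\<lambda>x. v x powr (1 - p'))" "AE x in half_line. h x = f x * g x"
    for f g
    using Ces_norm_product_le[OF assms(1,3) C(1,3)] that unfolding C(2) assms(2) by blast
  show iff: "h \<in> Ces p v \<longleftrightarrow>
       (\<exists>f \<in> Lp_space p v. \<exists>g \<in> G_space p' (\<lambda>x. v x powr (1 - p')).
          AE x in half_line. h x = f x * g x)"
  proof
    assume "h \<in> Ces p v"
    then show "\<exists>f \<in> Lp_space p v. \<exists>g \<in> G_space p' (\<lambda>x. v x powr (1 - p')).
          AE x in half_line. h x = f x * g x"
      unfolding assms(2) by (rule Ces_factorization_half_line[OF assms(1,3,4)]) blast
  next
    assume "\<exists>f \<in> Lp_space p v. \<exists>g \<in> G_space p' (\<lambda>x. v x powr (1 - p')).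
          AE x in half_line. h x = f x * g x"
    then obtain f g where fg: "f \<in> Lp_space p v" "g \<in> G_space p' (\<lambda>x. v x powr (1 - p'))"
      "AE x in half_line. h x = f x * g x" by blast
    then have "?K * (Lp_norm p v f * ?G g) < top"
      by (auto simp: C(2) Lp_space_def G_space_def ennreal_mult_less_top)
    then show "h \<in> Ces p v" using upper[OF fg] hm by (auto simp: Ces_def intro: le_less_trans)
  qed
  assume h: "h \<in> Ces p v"
  show "const_m p v * factor_norm p v h \<le> Ces_norm p v h"
  proof -
    obtain f g where fg: "f \<in> Lp_space p v" "g \<in> G_space p' (\<lambda>x. v x powr (1 - p'))"
      "AE x in half_line. h x = f x * g x" "Lp_norm p v f \<le> Ces_norm p v h"
      and g: "\<forall>C>0. (\<forall>t>0. M_expr p v t \<ge> ennreal C) \<longrightarrow> ?G g \<le> ennreal (1 / C)"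
      by (rule Ces_factorization_half_line[OF assms(1,3,4) h, folded assms(2)]) (rule that; assumption)
    have N: "factor_norm p v h \<le> Lp_norm p v f * ?G g"
      unfolding factor_norm_def using fg
      by (intro INF_lower2[of "(f, g)"]) (auto simp: factorizations_def assms(2))
    have "ennreal c * factor_norm p v h \<le> Ces_norm p v h"
      if c: "c > 0" "\<forall>t>0. M_expr p v t \<ge> ennreal c" for c
    proof -
      have "ennreal c * factor_norm p v h \<le> ennreal c * (Ces_norm p v h * ennreal (1 / c))"
        using c N fg(4) g by (intro mult_left_mono order_trans[OF N] mult_mono) auto
      also have "\<dots> = Ces_norm p v h * ennreal (c * (1 / c))"
        using c by (subst ennreal_mult) (auto simp: mult_ac)
      finally show ?thesis using c by simp
    qed
    then show ?thesis
      unfolding const_m_def SUP_mult_right_ennreal by (auto intro!: SUP_least)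
  qed
  show "Ces_norm p v h \<le> ?K * factor_norm p v h"
  proof -
    \<comment> \<open>a positive real constant can be moved across the infimum by division\<close>
    define k where "k = p' powr (1 / p') * p powr (1 / p) * C"
    have k: "k > 0" "?K = ennreal k"
      using assms(1,2) C conj_exp_properties[OF assms(1)] by (auto simp: k_def ennreal_mult)
    have "Ces_norm p v h * ennreal (1 / k) \<le> factor_norm p v h"
      unfolding factor_norm_def
    proof (rule INF_greatest, clarify)
      fix f g assume "(f, g) \<in> factorizations p v h"
      then have "Ces_norm p v h \<le> ennreal k * (Lp_norm p v f * ?G g)"
        using upper unfolding factorizations_def k(2)[symmetric] assms(2) by blast
      then have "Ces_norm p v h * ennreal (1 / k) \<le> ennreal k * (Lp_norm p v f * ?G g) * ennreal (1 / k)"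
        by (rule mult_right_mono) simp
      also have "\<dots> = ennreal (k * (1 / k)) * (Lp_norm p v f * ?G g)"
        using k by (subst ennreal_mult) (auto simp: mult_ac)
      finally show "Ces_norm p v h * ennreal (1 / k) \<le>
          Lp_norm p v f * G_norm (conj_exp p) (\<lambda>x. v x powr (1 - conj_exp p)) g"
        using k by (simp add: assms(2))
    qed
    then have "ennreal k * (Ces_norm p v h * ennreal (1 / k)) \<le> ?K * factor_norm p v h"
      unfolding k(2) by (rule mult_left_mono) simp
    moreover have "ennreal k * (Ces_norm p v h * ennreal (1 / k)) = Ces_norm p v h * ennreal (k * (1 / k))"
      using k by (subst ennreal_mult) (auto simp: mult_ac)
    ultimately show ?thesis using k by simp
  qed
qed

end
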